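(* Let $(R,\mathfrak m)$ be a Noetherian local ring of dimension $0$. Then $\tau_{\mathcal I} = \tau_{\mathcal M} = \operatorname{Soc} R$, where $\operatorname{Soc} R = (0:_R \mathfrak m)$ is the socle of $R$.
   Context: All rings are commutative with identity. Integral closure in a free module: let $F$ be a free $R$-module (not necessarily finitely generated) and $K \subseteq F$ a submodule. Let $S=\mathrm{Sym}_R(F)$ be the symmetric algebra with its natural grading ($S_1=F$), and let $T\subseteq S$ be the $R$-subalgebra generated by $K \subseteq F = S_1$. Then $K^-_F$ denotes the degree $1$ part of the integral closure of $T$ in $S$, i.e. the set of elements of $F$ that are integral over $T$. Liftable integral closure: let $L\subseteq M$ be $R$-modules, $\pi: F \to M$ a surjection from a free $R$-module $F$, and $K := \pi^{-1}(L)$. The liftable integral closure of $L$ in $M$ is $L^{\mathrm{li}}_M := \pi(K^-_F)$. It is a submodule of $M$ which does not depend on the choice of $\pi$. For a Noetherian local ring $R$: $\tau_{\mathcal M} := \bigcap_{M} \operatorname{ann} 0^{\mathrm{li}}_{M}$, the intersection over all artinian $R$-modules $M$; and $\tau_{\mathcal I} := \bigcap_{I} (I:\bar I)$, the intersection over all ideals $I$ of $R$, where $\bar I$ is the usual integral closure of $I$ and $(I:\bar I)=\{r\in R: r\bar I\subseteq I\}$. *)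

theory Defs
  imports "HOL-Algebra.Algebra" "HOL-Library.Extended_Nat" "HOL-Library.Multiset"
begin

section \<open>Local rings, Krull dimension, artinian modules\<close>

locale local_ring = cring R for R (structure) and \<mm> +
  assumes maximalideal: "maximalideal \<mm> R"
    and maximalideal_unique: "maximalideal \<nn> R \<Longrightarrow> \<nn> = \<mm>"

definition krull_dim :: "('a, 'c) ring_scheme \<Rightarrow> enat" where
  "krull_dim R = (SUP n \<in> {n. \<exists>P :: nat \<Rightarrow> 'a set.
      (\<forall>i\<le>n. primeideal (P i) R) \<and> (\<forall>i<n. P i \<subset> P (Suc i))}. enat n)"

definition artinian_module ::
    "('a, 'c) ring_scheme \<Rightarrow> ('a, 'm, 'd) module_scheme \<Rightarrow> bool" where
  "artinian_module R M \<longleftrightarrow> module R M \<and>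
     (\<forall>N :: nat \<Rightarrow> 'm set.
        (\<forall>i. submodule (N i) R M \<and> N (Suc i) \<subseteq> N i) \<longrightarrow> (\<exists>n. \<forall>k\<ge>n. N k = N n))"

definition annihilator ::
    "('a, 'c) ring_scheme \<Rightarrow> ('a, 'm, 'd) module_scheme \<Rightarrow> 'm set \<Rightarrow> 'a set" where
  "annihilator R M N = {r \<in> carrier R. \<forall>x\<in>N. r \<odot>\<^bsub>M\<^esub> x = \<zero>\<^bsub>M\<^esub>}"

definition colon :: "('a, 'c) ring_scheme \<Rightarrow> 'a set \<Rightarrow> 'a set \<Rightarrow> 'a set" where
  "colon R I J = {r \<in> carrier R. \<forall>x\<in>J. r \<otimes>\<^bsub>R\<^esub> x \<in> I}"


section \<open>Integral closure of subrings and of ideals\<close>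

definition integral_closure_in :: "('s, 'd) ring_scheme \<Rightarrow> 's set \<Rightarrow> 's set" where
  "integral_closure_in S T = {x \<in> carrier S. \<exists>n>0. \<exists>a :: nat \<Rightarrow> 's.
     (\<forall>i<n. a i \<in> T) \<and>
     x [^]\<^bsub>S\<^esub> n \<oplus>\<^bsub>S\<^esub> (\<Oplus>\<^bsub>S\<^esub>i\<in>{..<n}. a i \<otimes>\<^bsub>S\<^esub> x [^]\<^bsub>S\<^esub> i) = \<zero>\<^bsub>S\<^esub>}"

text \<open>Here \<open>a i\<close> lies in the \<open>i\<close>-th power of the ideal; powers of ideals are powers
  in the multiplicative monoid of \<^const>\<open>ideals_set\<close>.\<close>

definition ideal_integral_closure :: "('a, 'c) ring_scheme \<Rightarrow> 'a set \<Rightarrow> 'a set" where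
  "ideal_integral_closure R I = {x \<in> carrier R. \<exists>n>0. \<exists>a :: nat \<Rightarrow> 'a.
     (\<forall>i\<in>{1..n}. a i \<in> I [^]\<^bsub>ideals_set R\<^esub> i) \<and>
     x [^]\<^bsub>R\<^esub> n \<oplus>\<^bsub>R\<^esub> (\<Oplus>\<^bsub>R\<^esub>i\<in>{1..n}. a i \<otimes>\<^bsub>R\<^esub> x [^]\<^bsub>R\<^esub> (n - i)) = \<zero>\<^bsub>R\<^esub>}"


section \<open>Free modules and their symmetric algebras\<close>

text \<open>The free module on a basis \<open>B\<close>: finitely supported functions on \<open>B\<close>, extended by
  zero to the whole type. The ring fields of the module record play no role.\<close>

definition free_module :: "('a, 'c) ring_scheme \<Rightarrow> 'b set \<Rightarrow> ('a, 'b \<Rightarrow> 'a) module" where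
  "free_module R B = \<lparr>
     carrier = {f. (\<forall>b. f b \<in> carrier R) \<and> finite {b. f b \<noteq> \<zero>\<^bsub>R\<^esub>} \<and> {b. f b \<noteq> \<zero>\<^bsub>R\<^esub>} \<subseteq> B},
     monoid.mult = undefined, one = undefined,
     ring.zero = (\<lambda>b. \<zero>\<^bsub>R\<^esub>),
     add = (\<lambda>f g b. f b \<oplus>\<^bsub>R\<^esub> g b),
     smult = (\<lambda>r f b. r \<otimes>\<^bsub>R\<^esub> f b)\<rparr>"

text \<open>The symmetric algebra of the free module on \<open>B\<close> is the polynomial ring over \<open>R\<close> with
  the elements of \<open>B\<close> as variables. As in \<^theory>\<open>HOL-Algebra.Indexed_Polynomials\<close>, a
  monomial is a multiset of variables and a polynomial maps a monomial to its coefficient.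
  The degree of a monomial is its size.\<close>

definition free_sym :: "('a, 'c) ring_scheme \<Rightarrow> 'b set \<Rightarrow> ('a, 'b multiset \<Rightarrow> 'a) module" where
  "free_sym R B = \<lparr>
     carrier = {p. (\<forall>m. p m \<in> carrier R) \<and> finite {m. p m \<noteq> \<zero>\<^bsub>R\<^esub>} \<and>
                   (\<forall>m. p m \<noteq> \<zero>\<^bsub>R\<^esub> \<longrightarrow> set_mset m \<subseteq> B)},
     monoid.mult = (\<lambda>p q m. \<Oplus>\<^bsub>R\<^esub>k\<in>{k. k \<subseteq># m}. p k \<otimes>\<^bsub>R\<^esub> q (m - k)),
     one = ring.indexed_const R \<one>\<^bsub>R\<^esub>,
     ring.zero = ring.indexed_const R \<zero>\<^bsub>R\<^esub>,
     add = (\<lambda>p q m. p m \<oplus>\<^bsub>R\<^esub> q m),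
     smult = (\<lambda>r p m. r \<otimes>\<^bsub>R\<^esub> p m)\<rparr>"

text \<open>The identification of the free module with the degree 1 part of its symmetric
  algebra: \<open>f\<close> is sent to the linear form whose coefficient at the variable \<open>b\<close> is \<open>f b\<close>.\<close>

definition linear_form :: "('a, 'c) ring_scheme \<Rightarrow> ('b \<Rightarrow> 'a) \<Rightarrow> ('b multiset \<Rightarrow> 'a)" where
  "linear_form R f = (\<lambda>m. if size m = 1 then f (THE b. m = {#b#}) else \<zero>\<^bsub>R\<^esub>)"

definition generated_subalgebra ::
    "('a, 'c) ring_scheme \<Rightarrow> 'b set \<Rightarrow> ('b \<Rightarrow> 'a) set \<Rightarrow> ('b multiset \<Rightarrow> 'a) set" where
  "generated_subalgebra R B K =
     generate_ring (free_sym R B) (ring.indexed_const R ` carrier R \<union> linear_form R ` K)"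

definition free_integral_closure ::
    "('a, 'c) ring_scheme \<Rightarrow> 'b set \<Rightarrow> ('b \<Rightarrow> 'a) set \<Rightarrow> ('b \<Rightarrow> 'a) set" where
  "free_integral_closure R B K =
     {z \<in> carrier (free_module R B).
        linear_form R z \<in> integral_closure_in (free_sym R B) (generated_subalgebra R B K)}"


section \<open>Liftable integral closure\<close>

definition li_closure_wrt ::
    "('a, 'c) ring_scheme \<Rightarrow> 'b set \<Rightarrow> (('b \<Rightarrow> 'a) \<Rightarrow> 'm) \<Rightarrow> 'm set \<Rightarrow> 'm set" where
  "li_closure_wrt R B \<pi> L =
     \<pi> ` free_integral_closure R B {f \<in> carrier (free_module R B). \<pi> f \<in> L}"

text \<open>As the closure does not depend on the choice of a surjection from a free module, we
  use the canonical one: the free module on the set of all elements of \<open>M\<close>, with each basis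
  element sent to itself.\<close>

definition canonical_surj ::
    "('a, 'c) ring_scheme \<Rightarrow> ('a, 'm, 'd) module_scheme \<Rightarrow> ('m \<Rightarrow> 'a) \<Rightarrow> 'm" where
  "canonical_surj R M f = (\<Oplus>\<^bsub>M\<^esub>x\<in>{x. f x \<noteq> \<zero>\<^bsub>R\<^esub>}. f x \<odot>\<^bsub>M\<^esub> x)"

definition li_closure ::
    "('a, 'c) ring_scheme \<Rightarrow> ('a, 'm, 'd) module_scheme \<Rightarrow> 'm set \<Rightarrow> 'm set" where
  "li_closure R M L = li_closure_wrt R (carrier M) (canonical_surj R M) L"


section \<open>The two test ideals\<close>

definition tau_ideals :: "('a, 'c) ring_scheme \<Rightarrow> 'a set" where
  "tau_ideals R = (\<Inter>I\<in>{I. ideal I R}. colon R I (ideal_integral_closure R I))"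

text \<open>The intersection over all artinian modules whose carrier is a subset of the type \<open>'u\<close>.
  An artinian module over a Noetherian local ring is the union of its finite length submodules
  of elements killed by a fixed power of the maximal ideal, hence countably generated, hence
  isomorphic to a quotient of the free module on \<open>nat\<close>. The elements of such a
  quotient are cosets, which have type \<open>(nat \<Rightarrow> 'a) set\<close>. So \<open>'u\<close> meets every
  isomorphism class of artinian modules as soon as \<open>(nat \<Rightarrow> 'a) set\<close> embeds into \<open>'u\<close>.\<close>

definition tau_modules :: "'u itself \<Rightarrow> ('a, 'c) ring_scheme \<Rightarrow> 'a set" where
  "tau_modules U R =
     (\<Inter>M\<in>{M :: ('a, 'u) module. artinian_module R M}. annihilator R M (li_closure R M {\<zero>\<^bsub>M\<^esub>}))"

end

theory Submission
  imports Defs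
begin

text \<open>
  Over a Noetherian local ring \<open>R\<close> of dimension \<open>0\<close> the maximal ideal \<open>\<mm>\<close>
  consists of nilpotent elements, and every nilpotent element is integral over everything. Both
  closures are therefore as large as possible: each of them is governed by \<open>\<mm>\<close>, and the
  annihilator of \<open>\<mm>\<close> is the socle.

  For ideals, the integral closure of a proper ideal lies in \<open>\<mm>\<close>, because modulo
  \<open>\<mm>\<close> an integral equation says that a power vanishes; and the closure of \<open>0\<close> is
  \<open>\<mm>\<close> (\<open>tau_ideals_eq_socle\<close>).

  For modules, the closure of \<open>0\<close> in \<open>M\<close> is \<open>\<mm>M\<close>; two halves of this
  statement suffice. If \<open>M = R\<close> and \<open>x \<in> \<mm>\<close>, then \<open>x\<close> lifts to the nilpotent
  linear form \<open>x X\<close>, so the closure contains \<open>\<mm>\<close>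
  (\<open>max_subset_li_closure_regular\<close>). As \<open>R\<close> is an artinian module
  (\<open>artinian_regular_module_copy\<close>), every element of \<open>\<tau>\<close> kills \<open>\<mm>\<close>.

  Conversely the socle kills the closure of \<open>0\<close> in any module
  (\<open>socle_annihilates_li_closure\<close>). The reason is that over a field a linear form which is
  integral over the subalgebra generated by a space of linear forms belongs to that space. To see
  this, choose a linear functional \<open>\<phi>\<close> that vanishes on the space and takes the value
  \<open>1\<close> on the form, and substitute \<open>\<phi> b \<cdot> t\<close> for each variable \<open>b\<close>: the
  subalgebra becomes constant and the form becomes \<open>t\<close>, which is not integral over constants.
  Over \<open>R\<close> the functional exists only modulo \<open>\<mm>\<close>. It is constructed on \<open>M\<close>,
  with the help of Zorn's lemma, as a coordinate modulo a maximal submodule avoiding a given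
  element, and the substitution is carried out one coefficient at a time
  (\<open>component_value_integral_in_prime\<close>).
\<close>

section \<open>Sums in ideals, double sums and submultisets\<close>

lemma (in ideal) finsum_mem:
  assumes "\<And>i. i \<in> A \<Longrightarrow> f i \<in> I"
  shows "(\<Oplus>i\<in>A. f i) \<in> I"
  using assms
proof (induction A rule: infinite_finite_induct)
  case (insert a A)
  then have "(\<Oplus>i\<in>insert a A. f i) = f a \<oplus> (\<Oplus>i\<in>A. f i)"
    by (intro finsum_insert) (auto intro: Icarr)
  with insert show ?case by simp
qed simp_all

lemma (in primeideal) nat_pow_mem_imp_mem:
  assumes "x \<in> carrier R" "x [^] (n::nat) \<in> I"
  shows "x \<in> I"
  using assms(2)
proof (induction n)
  case 0
  then have "I = carrier R" by (intro one_imp_carrier) simp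
  then show ?case using I_notcarr by simp
next
  case (Suc n)
  then show ?case using I_prime[of "x [^] n" x] assms(1) by auto
qed

lemma (in abelian_monoid) finsum_Sigma:
  assumes "finite A" "\<And>a. a \<in> A \<Longrightarrow> finite (B a)"
    and "\<And>a b. a \<in> A \<Longrightarrow> b \<in> B a \<Longrightarrow> g (a, b) \<in> carrier G"
  shows "(\<Oplus>a\<in>A. \<Oplus>b\<in>B a. g (a, b)) = (\<Oplus>x\<in>Sigma A B. g x)"
  using assms
proof (induction A)
  case empty
  then show ?case by simp
next
  case (insert a A)
  have eq: "Sigma (insert a A) B = Pair a ` B a \<union> Sigma A B" by auto
  have "(\<Oplus>x\<in>Sigma (insert a A) B. g x) = (\<Oplus>x\<in>Pair a ` B a. g x) \<oplus> (\<Oplus>x\<in>Sigma A B. g x)"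
    unfolding eq by (rule finsum_Un_disjoint) (use insert in auto)
  also have "(\<Oplus>x\<in>Pair a ` B a. g x) = (\<Oplus>b\<in>B a. g (a, b))"
    by (rule finsum_reindex) (use insert in \<open>auto simp: inj_on_def\<close>)
  also have "(\<Oplus>x\<in>Sigma A B. g x) = (\<Oplus>a\<in>A. \<Oplus>b\<in>B a. g (a, b))"
    using insert by auto
  also have "(\<Oplus>b\<in>B a. g (a, b)) \<oplus> (\<Oplus>a\<in>A. \<Oplus>b\<in>B a. g (a, b)) = (\<Oplus>a\<in>insert a A. \<Oplus>b\<in>B a. g (a, b))"
    by (subst finsum_insert) (use insert in \<open>auto intro!: finsum_closed\<close>)
  finally show ?case by simp
qed

lemma finite_submultisets: "finite {k. k \<subseteq># (m :: 'v multiset)}"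
proof (induction m)
  case (add x m)
  have "{k. k \<subseteq># add_mset x m} \<subseteq> {k. k \<subseteq># m} \<union> add_mset x ` {k. k \<subseteq># m}"
  proof
    fix k assume k: "k \<in> {k. k \<subseteq># add_mset x m}"
    show "k \<in> {k. k \<subseteq># m} \<union> add_mset x ` {k. k \<subseteq># m}"
    proof (cases "x \<in># k")
      case True
      then obtain k' where "k = add_mset x k'" by (metis insert_DiffM)
      with k show ?thesis by auto
    next
      case False
      then have "count k b \<le> count m b" for b
        using k mset_subset_eq_count[of k "add_mset x m" b] by (cases "b = x") (auto simp: not_in_iff)
      then have "k \<subseteq># m" by (simp add: subseteq_mset_def)
      then show ?thesis by simp
    qed
  qed
  then show ?case using add.IH finite_subset by blast
qed simp

section \<open>Zero-dimensional Noetherian local rings\<close>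

text \<open>Zorn's lemma applies because, by the ascending chain condition, a nonempty chain
  of ideals contains its own union.\<close>

lemma (in noetherian_ring) ex_maximal_ideal_in_family:
  assumes "\<A> \<noteq> {}" and "\<And>I. I \<in> \<A> \<Longrightarrow> ideal I R"
  shows "\<exists>I\<in>\<A>. \<forall>J\<in>\<A>. I \<subseteq> J \<longrightarrow> J = I"
proof (rule subset_Zorn_nonempty[OF assms(1)])
  fix C assume C: "C \<noteq> {}" "subset.chain \<A> C"
  then have "subset.chain {I. ideal I R} C"
    using assms(2) by (auto simp: subset_chain_def)
  with C have "\<Union>C \<in> C" using ideal_chain_is_trivial by blast
  with C show "\<Union>C \<in> \<A>" by (auto simp: subset_chain_def)
qed

lemma (in ring) ideal_subset_set_add:
  assumes "ideal I R" "ideal J R"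
  shows "I \<subseteq> set_add R I J" "J \<subseteq> set_add R I J"
proof -
  interpret I: ideal I R by fact
  interpret J: ideal J R by fact
  have "x = x \<oplus> \<zero>" if "x \<in> I" for x using I.Icarr[OF that] by simp
  then show "I \<subseteq> set_add R I J"
    unfolding set_add_def' using J.zero_closed by blast
  have "x = \<zero> \<oplus> x" if "x \<in> J" for x using J.Icarr[OF that] by simp
  then show "J \<subseteq> set_add R I J"
    unfolding set_add_def' using I.zero_closed by blast
qed

lemma (in cring) ideal_colon_singleton:
  assumes "ideal J R" "y \<in> carrier R"
  shows "ideal (colon R J {y}) R"
proof -
  interpret J: ideal J R by fact
  show ?thesis
  proof (rule idealI[OF ring_axioms])
    show "subgroup (colon R J {y}) (add_monoid R)"
      by (rule add.subgroupI)
         (use assms(2) in \<open>auto simp: colon_def l_distr l_minus intro: exI[of _ \<zero>]\<close>)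
  next
    fix a x assume a: "a \<in> colon R J {y}" and x: "x \<in> carrier R"
    then have *: "x \<otimes> (a \<otimes> y) \<in> J" "a \<in> carrier R" by (auto simp: colon_def J.I_l_closed)
    then show 1: "x \<otimes> a \<in> colon R J {y}"
      using x assms(2) by (auto simp: colon_def m_assoc)
    show "a \<otimes> x \<in> colon R J {y}" using 1 m_comm[OF x *(2)] by simp
  qed
qed

text \<open>A proper ideal has an associated prime: among the ideals \<open>(J : y)\<close> with
  \<open>y \<notin> J\<close> a maximal one is prime, since \<open>a \<notin> (J : y)\<close> forces
  \<open>(J : ay) = (J : y)\<close>.\<close>

lemma (in noetherian_ring) ex_prime_colon:
  assumes "cring R" "ideal J R" "J \<noteq> carrier R"
  shows "\<exists>y\<in>carrier R - J. primeideal (colon R J {y}) R"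
proof -
  interpret cring R by fact
  interpret J: ideal J R by fact
  let ?\<A> = "(\<lambda>y. colon R J {y}) ` (carrier R - J)"
  have "?\<A> \<noteq> {}" using assms(3) J.Icarr by auto
  then obtain y where y: "y \<in> carrier R" "y \<notin> J"
    and max: "\<And>z. z \<in> carrier R - J \<Longrightarrow> colon R J {y} \<subseteq> colon R J {z}
                \<Longrightarrow> colon R J {z} = colon R J {y}"
    using ex_maximal_ideal_in_family[of ?\<A>] ideal_colon_singleton[OF assms(2)]
    by (auto simp: ball_simps bex_simps) blast
  have "primeideal (colon R J {y}) R"
  proof (rule primeidealI[OF ideal_colon_singleton[OF assms(2) y(1)] is_cring])
    show "carrier R \<noteq> colon R J {y}"
      using y by (auto simp: colon_def dest!: equalityD1 subsetD[of _ _ \<one>])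
  next
    fix a b assume ab: "a \<in> carrier R" "b \<in> carrier R" "a \<otimes> b \<in> colon R J {y}"
    have "b \<in> colon R J {y}" if "a \<notin> colon R J {y}"
    proof -
      have "a \<otimes> y \<in> carrier R - J" using that ab y by (auto simp: colon_def)
      moreover have "colon R J {y} \<subseteq> colon R J {a \<otimes> y}"
      proof
        fix r assume "r \<in> colon R J {y}"
        then have r: "r \<in> carrier R" "a \<otimes> (r \<otimes> y) \<in> J"
          using ab(1) J.I_l_closed by (auto simp: colon_def)
        moreover have "a \<otimes> (r \<otimes> y) = r \<otimes> (a \<otimes> y)" using m_lcomm ab(1) r(1) y(1) by blast
        ultimately show "r \<in> colon R J {a \<otimes> y}" by (simp add: colon_def)
      qed
      ultimately have "colon R J {a \<otimes> y} = colon R J {y}" by (rule max)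
      moreover have "b \<in> colon R J {a \<otimes> y}"
      proof -
        have "b \<otimes> (a \<otimes> y) = (a \<otimes> b) \<otimes> y" using ab(1,2) y(1) by algebra
        then show ?thesis using ab by (simp add: colon_def)
      qed
      ultimately show ?thesis by simp
    qed
    then show "a \<in> colon R J {y} \<or> b \<in> colon R J {y}" by blast
  qed
  with y show ?thesis by blast
qed

text \<open>Noetherian rings of dimension \<open>0\<close> are exactly the artinian ones; the implication
  that matters here is proved below as \<open>ideal_chain_stabilises\<close>.\<close>

locale artinian_local_ring = local_ring R \<mm> + noetherian_ring R
  for R (structure) and \<mm> +
  assumes krull_dim_zero: "krull_dim R = 0"
begin

sublocale max: primeideal \<mm> R
  by (rule maximalideal_prime[OF maximalideal])

lemma proper_ideal_subset:
  assumes "ideal I R" "I \<noteq> carrier R"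
  shows "I \<subseteq> \<mm>"
proof -
  let ?\<A> = "{J. ideal J R \<and> I \<subseteq> J \<and> J \<noteq> carrier R}"
  have "I \<in> ?\<A>" using assms by simp
  then have "\<exists>J\<in>?\<A>. \<forall>J'\<in>?\<A>. J \<subseteq> J' \<longrightarrow> J' = J"
    by (intro ex_maximal_ideal_in_family) blast+
  then obtain J where J: "J \<in> ?\<A>" and J_max: "\<forall>J'\<in>?\<A>. J \<subseteq> J' \<longrightarrow> J' = J" ..
  have "maximalideal J R"
  proof (rule maximalidealI)
    show "ideal J R" "carrier R \<noteq> J" using J by auto
    fix J' assume J': "ideal J' R" "J \<subseteq> J'" "J' \<subseteq> carrier R"
    then have "I \<subseteq> J'" using J by blast
    then show "J' = J \<or> J' = carrier R" using J_max J' by blast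
  qed
  then have "J = \<mm>" by (rule maximalideal_unique)
  then show ?thesis using J by simp
qed

lemma Units_if_not_in_max:
  assumes "r \<in> carrier R" "r \<notin> \<mm>"
  obtains r' where "r' \<in> carrier R" "r' \<otimes> r = \<one>"
proof -
  have "PIdl r = carrier R"
    using proper_ideal_subset[OF cgenideal_ideal[OF assms(1)]] cgenideal_self[OF assms(1)] assms(2)
    by blast
  then have "\<one> \<in> PIdl r" by simp
  then obtain r' where "r' \<in> carrier R" "\<one> = r' \<otimes> r"
    unfolding cgenideal_def by blast
  then show ?thesis using that[of r'] by simp
qed

lemma one_not_in_max: "\<one> \<notin> \<mm>"
proof
  assume "\<one> \<in> \<mm>"
  then have "\<mm> = carrier R" by (rule max.one_imp_carrier)
  then show False using max.I_notcarr by simp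
qed

text \<open>A prime other than \<open>\<mm>\<close> would be the first step of a chain of length one.\<close>

lemma prime_eq_max:
  assumes "primeideal P R"
  shows "P = \<mm>"
proof (rule ccontr)
  interpret P: primeideal P R by fact
  assume "P \<noteq> \<mm>"
  then have "P \<subset> \<mm>"
    using proper_ideal_subset[OF P.is_ideal] P.I_notcarr by auto
  let ?P = "\<lambda>i::nat. if i = 0 then P else \<mm>"
  have "(\<forall>i\<le>1. primeideal (?P i) R) \<and> (\<forall>i<1. ?P i \<subset> ?P (Suc i))"
    using \<open>P \<subset> \<mm>\<close> assms max.primeideal_axioms by (simp add: less_Suc_eq)
  then have "1 \<in> {n. \<exists>P. (\<forall>i\<le>n. primeideal (P i) R) \<and> (\<forall>i<n. P i \<subset> P (Suc i))}"
    by (intro CollectI exI[of _ ?P])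
  then have "enat 1 \<le> krull_dim R"
    unfolding krull_dim_def by (rule SUP_upper)
  then show False
    using krull_dim_zero by (simp add: zero_enat_def)
qed

text \<open>Noetherian induction on \<open>J\<close>: take a maximal \<open>J\<close> above which some chain
  \<open>N\<close> fails to stabilise. As \<open>\<mm>\<close> is the only prime, \<open>J\<close> has an associated
  prime \<open>(J : y) = \<mm>\<close>, so \<open>J + Ry\<close> covers \<open>J\<close>, and chains above \<open>J + Ry\<close>
  do stabilise. This settles the case in which every \<open>N i\<close> contains \<open>y\<close>. Otherwise
  \<open>N i \<inter> (J + Ry) = J\<close> from some point on, and an inclusion of ideals which have the same
  intersection with \<open>J + Ry\<close> and the same sum with it is an equality.\<close>

lemma ideal_chain_above_stabilises:
  assumes "ideal J R"
    and "\<And>i. ideal (N i) R \<and> J \<subseteq> N i \<and> N (Suc i) \<subseteq> N i"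
  shows "\<exists>n. \<forall>k\<ge>n. N k = N n"
proof (rule ccontr)
  assume contr: "\<nexists>n. \<forall>k\<ge>n. N k = N n"
  define stable where "stable J \<longleftrightarrow>
    (\<forall>N. (\<forall>i. ideal (N i) R \<and> J \<subseteq> N i \<and> N (Suc i) \<subseteq> N i) \<longrightarrow> (\<exists>n::nat. \<forall>k\<ge>n. N k = N n))" for J
  have "J \<in> {J. ideal J R \<and> \<not> stable J}"
    using assms contr unfolding stable_def by auto
  then obtain J where J: "ideal J R" "\<not> stable J"
    and J_max: "\<And>J'. ideal J' R \<Longrightarrow> J \<subseteq> J' \<Longrightarrow> J' \<noteq> J \<Longrightarrow> stable J'"
    using ex_maximal_ideal_in_family[of "{J. ideal J R \<and> \<not> stable J}"] by blast
  interpret J: ideal J R by fact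
  obtain N where N: "\<And>i. ideal (N i) R" "\<And>i. J \<subseteq> N i" "\<And>i. N (Suc i) \<subseteq> N i"
    and not_stable: "\<nexists>n::nat. \<forall>k\<ge>n. N k = N n"
    using J(2) unfolding stable_def by blast
  have N_anti: "N k \<subseteq> N n" if "n \<le> k" for n k
    using lift_Suc_antimono_le[of N, OF N(3) that] .
  have N_carr: "N k \<subseteq> carrier R" for k
    using N(1) by (simp add: additive_subgroup.a_subset ideal.axioms(1))
  have "J \<noteq> carrier R"
    using N(2) N_carr not_stable by (metis subset_antisym)
  then obtain y where y: "y \<in> carrier R" "y \<notin> J" and "primeideal (colon R J {y}) R"
    using ex_prime_colon[OF is_cring J(1)] by blast
  then have colon: "colon R J {y} = \<mm>" by (simp add: prime_eq_max)
  have Jy: "ideal (set_add R J (PIdl y)) R" "ideal (PIdl y) R"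
    using add_ideals[OF J(1)] y(1) cgenideal_ideal by auto
  have y_in: "y \<in> set_add R J (PIdl y)"
    using ideal_subset_set_add(2)[OF J(1) Jy(2)] cgenideal_self[OF y(1)] by blast
  have J_le: "J \<subseteq> set_add R J (PIdl y)"
    by (rule ideal_subset_set_add(1)[OF J(1) Jy(2)])
  have Jy_stable: "stable (set_add R J (PIdl y))"
    by (rule J_max[OF Jy(1) J_le]) (use y_in y(2) in auto)
  define N' where "N' i = set_add R (N i) (PIdl y)" for i
  have "ideal (N' i) R \<and> set_add R J (PIdl y) \<subseteq> N' i \<and> N' (Suc i) \<subseteq> N' i" for i
    using N add_ideals[OF N(1) Jy(2)] unfolding N'_def set_add_def' by blast
  then obtain n where n: "\<And>k. k \<ge> n \<Longrightarrow> N' k = N' n"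
    using Jy_stable unfolding stable_def by blast
  show False
  proof (cases "\<forall>i. y \<in> N i")
    case True
    have "set_add R J (PIdl y) \<subseteq> N i" for i
    proof -
      have "PIdl y \<subseteq> N i" using True cgenideal_minimal[OF N(1)] by blast
      then show ?thesis
        using N(2)[of i] additive_subgroup.a_closed[OF ideal.axioms(1)[OF N(1)]]
        unfolding set_add_def' by blast
    qed
    then show False using Jy_stable N(1,3) not_stable unfolding stable_def by blast
  next
    case False
    then obtain i where i: "y \<notin> N i" by blast
    \<comment> \<open>A multiplier \<open>r\<close> outside \<open>\<mm>\<close> is a unit and would put \<open>y\<close> into \<open>N i\<close>.\<close>
    have meet: "r \<otimes> y \<in> J" if r: "r \<in> carrier R" "r \<otimes> y \<in> N i" for r
    proof (cases "r \<in> \<mm>")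
      case True
      then show ?thesis using colon by (auto simp: colon_def)
    next
      case False
      then obtain r' where "r' \<in> carrier R" "r' \<otimes> r = \<one>"
        using Units_if_not_in_max r(1) by blast
      then have "y = r' \<otimes> (r \<otimes> y)" using r(1) y(1) by (simp flip: m_assoc)
      with i r(2) \<open>r' \<in> carrier R\<close> show ?thesis
        by (metis N(1) ideal.I_l_closed)
    qed
    have "N k = N (max n i)" if "k \<ge> max n i" for k
    proof
      show "N k \<subseteq> N (max n i)" using N_anti that by blast
      show "N (max n i) \<subseteq> N k"
      proof
        fix x assume x: "x \<in> N (max n i)"
        interpret Nk: ideal "N k" R by (rule N)
        interpret Ni: ideal "N i" R by (rule N)
        have xc: "x \<in> carrier R" using x N_carr by blast
        have "x \<in> N' (max n i)"
          unfolding N'_def using x ideal_subset_set_add(1)[OF N(1) Jy(2)] by blast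
        then have "x \<in> N' k" using n[of k] n[of "max n i"] that by auto
        then obtain a r where a: "a \<in> N k" "r \<in> carrier R" "x = a \<oplus> r \<otimes> y"
          unfolding N'_def set_add_def' cgenideal_def by auto
        have ac: "a \<in> carrier R" "a \<in> N i" using a(1) N_anti[of i k] that Nk.Icarr by auto
        have "r \<otimes> y = x \<ominus> a"
          using a ac(1) xc y(1) by algebra
        moreover have "x \<in> N i" using x N_anti[of i "max n i"] by auto
        ultimately have "r \<otimes> y \<in> N i"
          using ac(2) unfolding a_minus_def by simp
        then have "r \<otimes> y \<in> N k" using meet[OF a(2)] N(2) by blast
        then show "x \<in> N k" using a by simp
      qed
    qed
    then show False using not_stable by blast
  qed
qed

lemma ideal_chain_stabilises:
  assumes "\<And>i. ideal (N i) R" "\<And>i. N (Suc i) \<subseteq> N i"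
  shows "\<exists>n. \<forall>k\<ge>n. N k = N n"
proof (rule ideal_chain_above_stabilises[OF zeroideal])
  fix i
  have "\<zero> \<in> N i" using assms(1)[of i] by (simp add: additive_subgroup.zero_closed ideal.axioms(1))
  then show "ideal (N i) R \<and> {\<zero>} \<subseteq> N i \<and> N (Suc i) \<subseteq> N i"
    using assms by blast
qed

text \<open>The powers of \<open>x\<close> generate a descending chain, so \<open>x ^ n = r x ^ (n + 1)\<close> for
  some \<open>n\<close> and \<open>r\<close>; here \<open>1 - r x\<close> is a unit.\<close>

lemma max_nilpotent:
  assumes "x \<in> \<mm>"
  shows "\<exists>n>0::nat. x [^] n = \<zero>"
proof -
  have x: "x \<in> carrier R" using assms by (rule max.Icarr)
  have "PIdl (x [^] Suc i) \<subseteq> PIdl (x [^] i)" for i :: nat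
  proof (rule cgenideal_minimal)
    show "ideal (PIdl (x [^] i)) R" using x by (intro cgenideal_ideal) simp
    then show "x [^] Suc i \<in> PIdl (x [^] i)"
      using x ideal.I_r_closed[OF _ cgenideal_self[of "x [^] i"] x] by simp
  qed
  moreover have "ideal (PIdl (x [^] i)) R" for i :: nat
    using x by (intro cgenideal_ideal) simp
  ultimately have "\<exists>n::nat. \<forall>k\<ge>n. PIdl (x [^] k) = PIdl (x [^] n)"
    using ideal_chain_stabilises[of "\<lambda>i. PIdl (x [^] i)"] by blast
  then obtain n :: nat where n: "\<And>k. k \<ge> n \<Longrightarrow> PIdl (x [^] k) = PIdl (x [^] n)" by blast
  have "x [^] n \<in> PIdl (x [^] Suc n)"
    using n[of "Suc n"] cgenideal_self[of "x [^] n"] x by simp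
  then obtain r where r: "r \<in> carrier R" "x [^] n = r \<otimes> (x [^] n \<otimes> x)"
    unfolding cgenideal_def by auto
  have "\<one> \<ominus> r \<otimes> x \<notin> \<mm>"
  proof
    assume "\<one> \<ominus> r \<otimes> x \<in> \<mm>"
    moreover have "r \<otimes> x \<in> \<mm>" using r(1) assms max.I_l_closed by blast
    ultimately have "(\<one> \<ominus> r \<otimes> x) \<oplus> r \<otimes> x \<in> \<mm>" by simp
    moreover have "(\<one> \<ominus> r \<otimes> x) \<oplus> r \<otimes> x = \<one>" using r(1) x by algebra
    ultimately show False using one_not_in_max by simp
  qed
  then obtain u where u: "u \<in> carrier R" "u \<otimes> (\<one> \<ominus> r \<otimes> x) = \<one>"
    using Units_if_not_in_max[of "\<one> \<ominus> r \<otimes> x"] r(1) x by auto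
  \<comment> \<open>Treating \<open>x [^] n\<close> as an atom makes the remaining identities ring identities.\<close>
  define z where "z = x [^] n"
  have z: "z \<in> carrier R" "z = r \<otimes> (z \<otimes> x)" using r(2) x by (auto simp: z_def)
  have "z \<otimes> (\<one> \<ominus> r \<otimes> x) = z \<ominus> r \<otimes> (z \<otimes> x)" using z(1) x r(1) by algebra
  also have "\<dots> = \<zero>" using z by simp
  finally have "z \<otimes> (\<one> \<ominus> r \<otimes> x) = \<zero>" .
  have "z = z \<otimes> (u \<otimes> (\<one> \<ominus> r \<otimes> x))" using u z(1) by simp
  also have "\<dots> = u \<otimes> (z \<otimes> (\<one> \<ominus> r \<otimes> x))" using z(1) u(1) x r(1) by algebra
  also have "\<dots> = \<zero>" using u(1) \<open>z \<otimes> _ = \<zero>\<close> by simp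
  finally have "x [^] Suc n = \<zero>" using x by (simp add: z_def)
  then show ?thesis by blast
qed

lemma ideal_pow_subset:
  assumes "ideal I R" "I \<subseteq> \<mm>" "i > 0"
  shows "I [^]\<^bsub>ideals_set R\<^esub> (i::nat) \<subseteq> \<mm>"
proof -
  have pow: "ideal (I [^]\<^bsub>ideals_set R\<^esub> j) R" for j :: nat
    by (induction j) (use assms oneideal ideal_prod_is_ideal in \<open>auto simp: ideals_set_def nat_pow_def\<close>)
  obtain j where "i = Suc j" using assms(3) by (cases i) auto
  then have "I [^]\<^bsub>ideals_set R\<^esub> i = ideal_prod R (I [^]\<^bsub>ideals_set R\<^esub> j) I"
    by (simp add: ideals_set_def)
  then show ?thesis using ideal_prod_inter[OF pow assms(1)] assms(2) by fastforce
qed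

text \<open>Modulo \<open>\<mm>\<close> an equation of integral dependence over \<open>I\<close> reads \<open>x ^ n = 0\<close>.\<close>

lemma ideal_integral_closure_subset:
  assumes "ideal I R" "I \<subseteq> \<mm>"
  shows "ideal_integral_closure R I \<subseteq> \<mm>"
proof
  fix x assume "x \<in> ideal_integral_closure R I"
  then obtain n :: nat and a where x: "x \<in> carrier R" "n > 0"
    and a: "\<And>i. i \<in> {1..n} \<Longrightarrow> a i \<in> I [^]\<^bsub>ideals_set R\<^esub> i"
    and eq: "x [^] n \<oplus> (\<Oplus>i\<in>{1..n}. a i \<otimes> x [^] (n - i)) = \<zero>"
    unfolding ideal_integral_closure_def by blast
  have "a i \<in> \<mm>" if "i \<in> {1..n}" for i
    using a[OF that] ideal_pow_subset[OF assms, of i] that by auto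
  then have s: "(\<Oplus>i\<in>{1..n}. a i \<otimes> x [^] (n - i)) \<in> \<mm>"
    using x(1) max.I_r_closed by (intro max.finsum_mem) simp
  have "x [^] n = \<ominus> (\<Oplus>i\<in>{1..n}. a i \<otimes> x [^] (n - i))"
    using eq x(1) max.Icarr[OF s] by (metis add.inv_equality nat_pow_closed)
  with s have "x [^] n \<in> \<mm>" by simp
  then show "x \<in> \<mm>" using max.nat_pow_mem_imp_mem x(1) by blast
qed

text \<open>A nilpotent \<open>x\<close> satisfies the equation \<open>x ^ n = 0\<close>, in which all lower
  coefficients vanish.\<close>

lemma max_subset_integral_closure_zero: "\<mm> \<subseteq> ideal_integral_closure R {\<zero>}"
proof
  fix x assume "x \<in> \<mm>"
  then obtain n :: nat where n: "n > 0" "x [^] n = \<zero>" and x: "x \<in> carrier R"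
    using max_nilpotent max.Icarr by blast
  have "ideal ({\<zero>} [^]\<^bsub>ideals_set R\<^esub> i) R" for i :: nat
    by (induction i) (use zeroideal oneideal ideal_prod_is_ideal in \<open>auto simp: ideals_set_def nat_pow_def\<close>)
  then have zero: "\<zero> \<in> {\<zero>} [^]\<^bsub>ideals_set R\<^esub> i" for i :: nat
    using additive_subgroup.zero_closed ideal.axioms(1) by blast
  have "(\<Oplus>i\<in>{1..n}. \<zero> \<otimes> x [^] (n - i)) = (\<Oplus>i\<in>{1..n}. \<zero>)"
    using x by (intro finsum_cong) auto
  then have "x [^] n \<oplus> (\<Oplus>i\<in>{1..n}. \<zero> \<otimes> x [^] (n - i)) = \<zero>"
    using n(2) finsum_zero by simp
  with n x zero show "x \<in> ideal_integral_closure R {\<zero>}"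
    unfolding ideal_integral_closure_def by (auto intro!: exI[of _ n] exI[of _ "\<lambda>_. \<zero>"])
qed

text \<open>The closure of a proper ideal lies in \<open>\<mm>\<close> and is killed by the socle, while the
  closure of the zero ideal is all of \<open>\<mm>\<close>.\<close>

lemma tau_ideals_eq_socle: "tau_ideals R = colon R {\<zero>} \<mm>"
proof
  show "tau_ideals R \<subseteq> colon R {\<zero>} \<mm>"
    unfolding tau_ideals_def using zeroideal max_subset_integral_closure_zero
    by (force simp: colon_def)
  show "colon R {\<zero>} \<mm> \<subseteq> tau_ideals R"
  proof
    fix s assume s: "s \<in> colon R {\<zero>} \<mm>"
    have "s \<in> colon R I (ideal_integral_closure R I)" if I: "ideal I R" for I
    proof (cases "I = carrier R")
      case True
      then show ?thesis using s by (auto simp: colon_def ideal_integral_closure_def)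
    next
      case False
      then have "ideal_integral_closure R I \<subseteq> \<mm>"
        using ideal_integral_closure_subset[OF I proper_ideal_subset[OF I]] by blast
      moreover have "\<zero> \<in> I"
        using I by (simp add: additive_subgroup.zero_closed ideal.axioms(1))
      ultimately show ?thesis using s by (auto simp: colon_def)
    qed
    then show "s \<in> tau_ideals R" by (auto simp: tau_ideals_def)
  qed
qed

end

section \<open>The symmetric algebra of a free module\<close>

context cring
begin

lemma free_sym_coeff_closed: "p \<in> carrier (free_sym R B) \<Longrightarrow> p m \<in> carrier R"
  by (simp add: free_sym_def)

lemma free_sym_finite: "p \<in> carrier (free_sym R B) \<Longrightarrow> finite {m. p m \<noteq> \<zero>}"
  by (simp add: free_sym_def)

lemma free_sym_simps:
  "\<zero>\<^bsub>free_sym R B\<^esub> = (\<lambda>_. \<zero>)"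
  "\<one>\<^bsub>free_sym R B\<^esub> = (\<lambda>m. if m = {#} then \<one> else \<zero>)"
  "p \<oplus>\<^bsub>free_sym R B\<^esub> q = (\<lambda>m. p m \<oplus> q m)"
  "p \<otimes>\<^bsub>free_sym R B\<^esub> q = (\<lambda>m. \<Oplus>k\<in>{k. k \<subseteq># m}. p k \<otimes> q (m - k))"
  by (simp_all add: free_sym_def indexed_const_def)

lemma free_sym_add_closed:
  assumes "p \<in> carrier (free_sym R B)" "q \<in> carrier (free_sym R B)"
  shows "p \<oplus>\<^bsub>free_sym R B\<^esub> q \<in> carrier (free_sym R B)"
proof -
  have "{m. p m \<oplus> q m \<noteq> \<zero>} \<subseteq> {m. p m \<noteq> \<zero>} \<union> {m. q m \<noteq> \<zero>}" by auto
  then have "finite {m. p m \<oplus> q m \<noteq> \<zero>}"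
    by (rule finite_subset) (use assms free_sym_finite in blast)
  moreover have "set_mset m \<subseteq> B" if "p m \<oplus> q m \<noteq> \<zero>" for m
  proof -
    have "p m \<noteq> \<zero> \<or> q m \<noteq> \<zero>" using that by auto
    then show ?thesis using assms by (auto simp: free_sym_def)
  qed
  ultimately show ?thesis using assms by (simp add: free_sym_def)
qed

lemma abelian_group_free_sym: "abelian_group (free_sym R B)"
proof (rule abelian_groupI)
  fix p assume p: "p \<in> carrier (free_sym R B)"
  then have "(\<lambda>m. \<ominus> p m) \<in> carrier (free_sym R B)"
    by (auto simp: free_sym_def)
  moreover have "(\<lambda>m. \<ominus> p m) \<oplus>\<^bsub>free_sym R B\<^esub> p = \<zero>\<^bsub>free_sym R B\<^esub>"
    using free_sym_coeff_closed[OF p] by (simp add: free_sym_simps l_neg)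
  ultimately show "\<exists>q\<in>carrier (free_sym R B). q \<oplus>\<^bsub>free_sym R B\<^esub> p = \<zero>\<^bsub>free_sym R B\<^esub>" by blast
next
  fix p q r
  assume pqr: "p \<in> carrier (free_sym R B)" "q \<in> carrier (free_sym R B)" "r \<in> carrier (free_sym R B)"
  note [simp] = pqr[THEN free_sym_coeff_closed]
  show "p \<oplus>\<^bsub>free_sym R B\<^esub> q \<oplus>\<^bsub>free_sym R B\<^esub> r = p \<oplus>\<^bsub>free_sym R B\<^esub> (q \<oplus>\<^bsub>free_sym R B\<^esub> r)"
    by (simp add: free_sym_simps a_assoc)
next
  fix p q
  assume pq: "p \<in> carrier (free_sym R B)" "q \<in> carrier (free_sym R B)"
  note [simp] = pq[THEN free_sym_coeff_closed]
  show "p \<oplus>\<^bsub>free_sym R B\<^esub> q = q \<oplus>\<^bsub>free_sym R B\<^esub> p"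
    by (rule ext) (simp add: free_sym_simps a_comm)
next
  show "\<zero>\<^bsub>free_sym R B\<^esub> \<in> carrier (free_sym R B)"
    unfolding free_sym_simps by (simp add: free_sym_def)
next
  fix p assume p: "p \<in> carrier (free_sym R B)"
  show "\<zero>\<^bsub>free_sym R B\<^esub> \<oplus>\<^bsub>free_sym R B\<^esub> p = p"
    by (simp add: free_sym_simps free_sym_coeff_closed[OF p])
qed (rule free_sym_add_closed)

lemma free_sym_a_inv:
  assumes p: "p \<in> carrier (free_sym R B)"
  shows "\<ominus>\<^bsub>free_sym R B\<^esub> p = (\<lambda>m. \<ominus> p m)"
proof -
  interpret S: abelian_group "free_sym R B" by (rule abelian_group_free_sym)
  have "(\<lambda>m. \<ominus> p m) \<in> carrier (free_sym R B)"
    using p by (auto simp: free_sym_def)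
  moreover have "(\<lambda>m. \<ominus> p m) \<oplus>\<^bsub>free_sym R B\<^esub> p = \<zero>\<^bsub>free_sym R B\<^esub>"
    using free_sym_coeff_closed[OF p] by (simp add: free_sym_simps l_neg)
  ultimately show ?thesis using S.minus_equality p by blast
qed

lemma free_sym_one_closed: "\<one>\<^bsub>free_sym R B\<^esub> \<in> carrier (free_sym R B)"
proof -
  have "{m. (if m = {#} then \<one> else \<zero>) \<noteq> \<zero>} \<subseteq> {{#}}" by auto
  then have "finite {m :: 'v multiset. (if m = {#} then \<one> else \<zero>) \<noteq> \<zero>}"
    using finite_subset by blast
  then show ?thesis
    unfolding free_sym_simps by (auto simp: free_sym_def)
qed

lemma indexed_const_closed:
  assumes "r \<in> carrier R"
  shows "indexed_const r \<in> carrier (free_sym R B)"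
proof -
  have "{m. indexed_const r m \<noteq> \<zero>} \<subseteq> {{#}}" by (auto simp: indexed_const_def)
  then have "finite {m :: 'v multiset. indexed_const r m \<noteq> \<zero>}"
    using finite_subset by blast
  then show ?thesis
    using assms by (auto simp: free_sym_def indexed_const_def)
qed

lemma free_sym_mult_support:
  assumes p: "p \<in> carrier (free_sym R B)" and q: "q \<in> carrier (free_sym R B)"
    and m: "(p \<otimes>\<^bsub>free_sym R B\<^esub> q) m \<noteq> \<zero>"
  shows "\<exists>k l. p k \<noteq> \<zero> \<and> q l \<noteq> \<zero> \<and> m = k + l"
proof (rule ccontr)
  assume contr: "\<nexists>k l. p k \<noteq> \<zero> \<and> q l \<noteq> \<zero> \<and> m = k + l"
  have "p k \<otimes> q (m - k) = \<zero>" if "k \<subseteq># m" for k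
  proof -
    have "m = k + (m - k)" using that by simp
    with contr have "p k = \<zero> \<or> q (m - k) = \<zero>" by blast
    then show ?thesis using free_sym_coeff_closed[OF p] free_sym_coeff_closed[OF q] by auto
  qed
  then have "(p \<otimes>\<^bsub>free_sym R B\<^esub> q) m = \<zero>"
    unfolding free_sym_simps by (intro add.finprod_one_eqI) auto
  with m show False by simp
qed

lemma free_sym_mult_closed:
  assumes p: "p \<in> carrier (free_sym R B)" and q: "q \<in> carrier (free_sym R B)"
  shows "p \<otimes>\<^bsub>free_sym R B\<^esub> q \<in> carrier (free_sym R B)"
proof -
  let ?pq = "p \<otimes>\<^bsub>free_sym R B\<^esub> q"
  have coeff: "?pq m \<in> carrier R" for m
    unfolding free_sym_simps
    by (intro finsum_closed) (use free_sym_coeff_closed p q in auto)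
  have "{m. ?pq m \<noteq> \<zero>} \<subseteq> (\<lambda>(k, l). k + l) ` ({k. p k \<noteq> \<zero>} \<times> {l. q l \<noteq> \<zero>})"
    using free_sym_mult_support[OF p q] by fastforce
  then have fin: "finite {m. ?pq m \<noteq> \<zero>}"
    by (rule finite_subset) (use p q free_sym_finite in blast)
  have "set_mset m \<subseteq> B" if "?pq m \<noteq> \<zero>" for m
  proof -
    obtain k l where "p k \<noteq> \<zero>" "q l \<noteq> \<zero>" "m = k + l"
      using free_sym_mult_support[OF p q \<open>?pq m \<noteq> \<zero>\<close>] by blast
    moreover have "set_mset k \<subseteq> B" "set_mset l \<subseteq> B"
      using p q \<open>p k \<noteq> \<zero>\<close> \<open>q l \<noteq> \<zero>\<close> by (auto simp: free_sym_def)
    ultimately show ?thesis by simp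
  qed
  with coeff fin show ?thesis by (simp add: free_sym_def)
qed

lemma free_sym_pow_closed:
  "p \<in> carrier (free_sym R B) \<Longrightarrow> p [^]\<^bsub>free_sym R B\<^esub> (n::nat) \<in> carrier (free_sym R B)"
  by (induction n) (simp_all add: free_sym_one_closed free_sym_mult_closed)

lemma linear_form_single: "linear_form R f {#b#} = f b"
  by (simp add: linear_form_def)

lemma linear_form_support:
  "{m. linear_form R f m \<noteq> \<zero>} = (\<lambda>b. {#b#}) ` {b. f b \<noteq> \<zero>}"
proof (intro equalityI subsetI)
  fix m assume m: "m \<in> {m. linear_form R f m \<noteq> \<zero>}"
  then have "size m = 1" by (auto simp: linear_form_def split: if_splits)
  then obtain b where "m = {#b#}" by (metis One_nat_def size_1_singleton_mset)
  with m show "m \<in> (\<lambda>b. {#b#}) ` {b. f b \<noteq> \<zero>}" by (simp add: linear_form_single)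
qed (auto simp: linear_form_single)

lemma linear_form_closed:
  assumes "f \<in> carrier (free_module R B)"
  shows "linear_form R f \<in> carrier (free_sym R B)"
proof -
  have "linear_form R f m \<in> carrier R" for m
    using assms by (simp add: free_module_def linear_form_def)
  moreover have "finite {m. linear_form R f m \<noteq> \<zero>}"
    unfolding linear_form_support using assms by (simp add: free_module_def)
  moreover have "set_mset m \<subseteq> B" if "linear_form R f m \<noteq> \<zero>" for m
  proof -
    have "m \<in> (\<lambda>b. {#b#}) ` {b. f b \<noteq> \<zero>}" using that linear_form_support[of f] by blast
    then show ?thesis using assms by (auto simp: free_module_def)
  qed
  ultimately show ?thesis by (simp add: free_sym_def)
qed

lemma generated_subalgebra_closed:
  assumes "K \<subseteq> carrier (free_module R B)" and "p \<in> generated_subalgebra R B K"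
  shows "p \<in> carrier (free_sym R B)"
  using assms(2) unfolding generated_subalgebra_def
proof (induction rule: generate_ring.induct)
  case one then show ?case by (rule free_sym_one_closed)
next
  case (incl h)
  then show ?case using assms(1) indexed_const_closed linear_form_closed by blast
next
  case (a_inv h)
  then show ?case using abelian_group.a_inv_closed[OF abelian_group_free_sym] by blast
next
  case (eng_add h1 h2) then show ?case by (simp add: free_sym_add_closed)
next
  case (eng_mult h1 h2) then show ?case by (simp add: free_sym_mult_closed)
qed

lemma nilpotent_in_integral_closure:
  assumes f: "f \<in> carrier (free_module R B)"
    and n: "n > 0" "linear_form R f [^]\<^bsub>free_sym R B\<^esub> (n::nat) = \<zero>\<^bsub>free_sym R B\<^esub>"
  shows "f \<in> free_integral_closure R B K"
proof -
  interpret S: abelian_group "free_sym R B" by (rule abelian_group_free_sym)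
  let ?S = "free_sym R B"
  have "\<zero>\<^bsub>?S\<^esub> = indexed_const \<zero>" by (simp add: free_sym_def)
  then have zero: "\<zero>\<^bsub>?S\<^esub> \<in> generated_subalgebra R B K"
    unfolding generated_subalgebra_def by (auto intro!: generate_ring.incl)
  have "\<zero>\<^bsub>?S\<^esub> \<otimes>\<^bsub>?S\<^esub> linear_form R f [^]\<^bsub>?S\<^esub> i = \<zero>\<^bsub>?S\<^esub>" for i :: nat
    unfolding free_sym_simps
    using free_sym_coeff_closed[OF free_sym_pow_closed[OF linear_form_closed[OF f]]]
    by (intro ext add.finprod_one_eqI) simp
  then have "(\<Oplus>\<^bsub>?S\<^esub>i\<in>{..<n}. \<zero>\<^bsub>?S\<^esub> \<otimes>\<^bsub>?S\<^esub> linear_form R f [^]\<^bsub>?S\<^esub> i) = \<zero>\<^bsub>?S\<^esub>"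
    by simp
  then have "linear_form R f [^]\<^bsub>?S\<^esub> n \<oplus>\<^bsub>?S\<^esub>
      (\<Oplus>\<^bsub>?S\<^esub>i\<in>{..<n}. \<zero>\<^bsub>?S\<^esub> \<otimes>\<^bsub>?S\<^esub> linear_form R f [^]\<^bsub>?S\<^esub> i) = \<zero>\<^bsub>?S\<^esub>"
    using n(2) by simp
  then show ?thesis
    using f n(1) zero linear_form_closed[OF f]
    unfolding free_integral_closure_def integral_closure_in_def
    by (auto intro!: exI[of _ n] exI[of _ "\<lambda>_. \<zero>\<^bsub>?S\<^esub>"])
qed

text \<open>Raising to a power preserves divisibility of all coefficients, which is how
  nilpotency of \<open>x\<close> passes to polynomials with coefficients divisible by \<open>x\<close>.\<close>

lemma free_sym_pow_coeff:
  assumes x: "x \<in> carrier R" and p: "\<And>m. p m \<in> PIdl x"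
  shows "(p [^]\<^bsub>free_sym R B\<^esub> (n::nat)) m \<in> PIdl (x [^] n)"
proof (induction n arbitrary: m)
  case 0
  have "PIdl \<one> = carrier R"
    using ideal.one_imp_carrier[OF cgenideal_ideal[OF one_closed] cgenideal_self[OF one_closed]] .
  then show ?case by (simp add: free_sym_simps)
next
  case (Suc n)
  interpret P: ideal "PIdl (x [^] Suc n)" R
    by (rule cgenideal_ideal) (use x in simp)
  have "(p [^]\<^bsub>free_sym R B\<^esub> n) k \<otimes> p (m - k) \<in> PIdl (x [^] Suc n)" for k
  proof -
    obtain a b where ab: "a \<in> carrier R" "b \<in> carrier R"
      "(p [^]\<^bsub>free_sym R B\<^esub> n) k = a \<otimes> x [^] n" "p (m - k) = b \<otimes> x"
      using Suc.IH[of k] p[of "m - k"] unfolding cgenideal_def by blast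
    have "(a \<otimes> z) \<otimes> (b \<otimes> x) = (a \<otimes> b) \<otimes> (z \<otimes> x)" if "z \<in> carrier R" for z
      using ab(1,2) x that by algebra
    from this[of "x [^] n"]
    have "(p [^]\<^bsub>free_sym R B\<^esub> n) k \<otimes> p (m - k) = (a \<otimes> b) \<otimes> x [^] Suc n"
      using x by (simp only: ab(3,4) nat_pow_Suc nat_pow_closed)
    then show ?thesis using ab(1,2) unfolding cgenideal_def by blast
  qed
  then have "((p [^]\<^bsub>free_sym R B\<^esub> n) \<otimes>\<^bsub>free_sym R B\<^esub> p) m \<in> PIdl (x [^] Suc n)"
    unfolding free_sym_simps by (rule P.finsum_mem)
  then show ?case by (simp only: Group.nat_pow_Suc)
qed

end

section \<open>Evaluation of homogeneous components\<close>

context cring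
begin

definition monomial_value :: "('v \<Rightarrow> 'a) \<Rightarrow> 'v multiset \<Rightarrow> 'a" where
  "monomial_value \<phi> m = (\<Otimes>b\<in>set_mset m. \<phi> b [^] count m b)"

text \<open>For a polynomial \<open>p\<close> this is the coefficient of \<open>t ^ n\<close> in the
  univariate polynomial obtained from \<open>p\<close> by substituting \<open>\<phi> b \<cdot> t\<close> for each
  variable \<open>b\<close>. The degree \<open>n\<close> keeps track of the power of \<open>t\<close>; merely
  substituting \<open>\<phi> b\<close> for \<open>b\<close> would lose the grading.\<close>

definition component_value :: "('v \<Rightarrow> 'a) \<Rightarrow> nat \<Rightarrow> ('v multiset \<Rightarrow> 'a) \<Rightarrow> 'a" where
  "component_value \<phi> n p = (\<Oplus>m\<in>{m. p m \<noteq> \<zero> \<and> size m = n}. p m \<otimes> monomial_value \<phi> m)"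

context
  fixes \<phi> :: "'v \<Rightarrow> 'a"
  assumes \<phi>: "\<And>b. \<phi> b \<in> carrier R"
begin

lemma monomial_value_closed [simp]: "monomial_value \<phi> m \<in> carrier R"
  unfolding monomial_value_def using \<phi> by (intro finprod_closed) auto

lemma monomial_value_superset:
  assumes "finite A" "set_mset m \<subseteq> A"
  shows "monomial_value \<phi> m = (\<Otimes>b\<in>A. \<phi> b [^] count m b)"
  unfolding monomial_value_def
  by (rule finprod_mono_neutral_cong_left) (use assms \<phi> in \<open>auto simp: not_in_iff\<close>)

lemma monomial_value_plus:
  "monomial_value \<phi> (k + l) = monomial_value \<phi> k \<otimes> monomial_value \<phi> l"
proof -
  let ?A = "set_mset k \<union> set_mset l"
  have "monomial_value \<phi> (k + l) = (\<Otimes>b\<in>?A. \<phi> b [^] count k b \<otimes> \<phi> b [^] count l b)"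
    by (subst monomial_value_superset[of ?A]) (use \<phi> in \<open>auto simp: nat_pow_mult\<close>)
  also have "\<dots> = (\<Otimes>b\<in>?A. \<phi> b [^] count k b) \<otimes> (\<Otimes>b\<in>?A. \<phi> b [^] count l b)"
    by (rule finprod_multf) (use \<phi> in auto)
  also have "\<dots> = monomial_value \<phi> k \<otimes> monomial_value \<phi> l"
    by (simp add: monomial_value_superset[of ?A])
  finally show ?thesis .
qed

lemma monomial_value_empty: "monomial_value \<phi> {#} = \<one>"
  by (simp add: monomial_value_def)

lemma monomial_value_single: "monomial_value \<phi> {#b#} = \<phi> b"
  using \<phi> by (simp add: monomial_value_def)

lemma component_value_closed [simp]:
  "p \<in> carrier (free_sym R B) \<Longrightarrow> component_value \<phi> n p \<in> carrier R"
  unfolding component_value_def by (intro finsum_closed) (auto simp: free_sym_coeff_closed)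

lemma component_value_superset:
  assumes p: "p \<in> carrier (free_sym R B)"
    and "finite A" "{m. p m \<noteq> \<zero> \<and> size m = n} \<subseteq> A" "\<And>m. m \<in> A \<Longrightarrow> size m = n"
  shows "component_value \<phi> n p = (\<Oplus>m\<in>A. p m \<otimes> monomial_value \<phi> m)"
  unfolding component_value_def
  by (rule add.finprod_mono_neutral_cong_left) (use assms free_sym_coeff_closed[OF p] in auto)

lemma component_value_add:
  assumes p: "p \<in> carrier (free_sym R B)" and q: "q \<in> carrier (free_sym R B)"
  shows "component_value \<phi> n (p \<oplus>\<^bsub>free_sym R B\<^esub> q) = component_value \<phi> n p \<oplus> component_value \<phi> n q"
proof -
  let ?A = "{m. (p m \<noteq> \<zero> \<or> q m \<noteq> \<zero>) \<and> size m = n}"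
  have "?A \<subseteq> {m. p m \<noteq> \<zero>} \<union> {m. q m \<noteq> \<zero>}" by auto
  then have fin: "finite ?A"
    using free_sym_finite[OF p] free_sym_finite[OF q] by (meson finite_UnI finite_subset)
  note [simp] = free_sym_coeff_closed[OF p] free_sym_coeff_closed[OF q]
  have "component_value \<phi> n (p \<oplus>\<^bsub>free_sym R B\<^esub> q)
        = (\<Oplus>m\<in>?A. (p \<oplus>\<^bsub>free_sym R B\<^esub> q) m \<otimes> monomial_value \<phi> m)"
    by (rule component_value_superset[OF free_sym_add_closed[OF p q] fin])
       (auto simp: free_sym_simps)
  also have "\<dots> = (\<Oplus>m\<in>?A. p m \<otimes> monomial_value \<phi> m \<oplus> q m \<otimes> monomial_value \<phi> m)"
    by (rule finsum_cong') (auto simp: free_sym_simps l_distr)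
  also have "\<dots> = (\<Oplus>m\<in>?A. p m \<otimes> monomial_value \<phi> m) \<oplus> (\<Oplus>m\<in>?A. q m \<otimes> monomial_value \<phi> m)"
    by (rule finsum_addf) auto
  also have "(\<Oplus>m\<in>?A. p m \<otimes> monomial_value \<phi> m) = component_value \<phi> n p"
    by (rule component_value_superset[OF p fin, symmetric]) auto
  also have "(\<Oplus>m\<in>?A. q m \<otimes> monomial_value \<phi> m) = component_value \<phi> n q"
    by (rule component_value_superset[OF q fin, symmetric]) auto
  finally show ?thesis .
qed

lemma component_value_zero: "component_value \<phi> n \<zero>\<^bsub>free_sym R B\<^esub> = \<zero>"
  by (simp add: component_value_def free_sym_simps)

lemma component_value_a_inv:
  assumes p: "p \<in> carrier (free_sym R B)"
  shows "component_value \<phi> n (\<ominus>\<^bsub>free_sym R B\<^esub> p) = \<ominus> component_value \<phi> n p"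
proof -
  interpret S: abelian_group "free_sym R B" by (rule abelian_group_free_sym)
  have "component_value \<phi> n (\<ominus>\<^bsub>free_sym R B\<^esub> p) \<oplus> component_value \<phi> n p
        = component_value \<phi> n (\<ominus>\<^bsub>free_sym R B\<^esub> p \<oplus>\<^bsub>free_sym R B\<^esub> p)"
    using p by (simp add: component_value_add)
  also have "\<dots> = \<zero>" using p by (simp add: S.l_neg component_value_zero)
  finally show ?thesis using p by (metis S.a_inv_closed component_value_closed minus_equality)
qed

lemma component_value_finsum:
  assumes "finite A" "\<And>i. i \<in> A \<Longrightarrow> p i \<in> carrier (free_sym R B)"
  shows "component_value \<phi> n (\<Oplus>\<^bsub>free_sym R B\<^esub>i\<in>A. p i) = (\<Oplus>i\<in>A. component_value \<phi> n (p i))"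
proof -
  interpret S: abelian_group "free_sym R B" by (rule abelian_group_free_sym)
  show ?thesis
    using assms
  proof (induction A)
    case empty
    then show ?case by (simp add: component_value_zero)
  next
    case (insert a A)
    have "component_value \<phi> n (p a \<oplus>\<^bsub>free_sym R B\<^esub> (\<Oplus>\<^bsub>free_sym R B\<^esub>i\<in>A. p i))
          = component_value \<phi> n (p a) \<oplus> component_value \<phi> n (\<Oplus>\<^bsub>free_sym R B\<^esub>i\<in>A. p i)"
      by (rule component_value_add) (use insert in \<open>auto intro!: S.finsum_closed\<close>)
    moreover have "(\<Oplus>\<^bsub>free_sym R B\<^esub>i\<in>insert a A. p i)
                   = p a \<oplus>\<^bsub>free_sym R B\<^esub> (\<Oplus>\<^bsub>free_sym R B\<^esub>i\<in>A. p i)"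
      by (rule S.finsum_insert) (use insert in auto)
    moreover have "(\<Oplus>i\<in>insert a A. component_value \<phi> n (p i))
                   = component_value \<phi> n (p a) \<oplus> (\<Oplus>i\<in>A. component_value \<phi> n (p i))"
      by (rule finsum_insert) (use insert component_value_closed[OF insert.prems] in auto)
    ultimately show ?case using insert by simp
  qed
qed

text \<open>The Cauchy product, which expresses that substituting \<open>\<phi> b \<cdot> t\<close> for \<open>b\<close>
  respects products. Both sides are the sum of
  \<open>p\<^sub>k q\<^sub>l \<phi>\<^sup>k \<phi>\<^sup>l\<close> over the set \<open>Z\<close> of pairs of monomials in the
  supports with total degree \<open>n\<close>: the left one grouped by the product monomial
  \<open>m = k + l\<close>, the right one by the degree of \<open>k\<close>.\<close>

lemma component_value_mult:
  assumes p: "p \<in> carrier (free_sym R B)" and q: "q \<in> carrier (free_sym R B)"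
  shows "component_value \<phi> n (p \<otimes>\<^bsub>free_sym R B\<^esub> q)
         = (\<Oplus>i\<in>{..n}. component_value \<phi> i p \<otimes> component_value \<phi> (n - i) q)"
proof -
  let ?v = "monomial_value \<phi>"
  let ?P = "{k. p k \<noteq> \<zero>}" and ?Q = "{l. q l \<noteq> \<zero>}"
  define g where "g = (\<lambda>(k, l). (p k \<otimes> q l) \<otimes> (?v k \<otimes> ?v l))"
  define Z where "Z = {(k, l). k \<in> ?P \<and> l \<in> ?Q \<and> size k + size l = n}"
  define W where "W = (\<lambda>(k, l). k + l) ` Z"
  note [simp] = free_sym_coeff_closed[OF p] free_sym_coeff_closed[OF q]
  note fin = free_sym_finite[OF p] free_sym_finite[OF q]
  have g_closed: "g x \<in> carrier R" for x by (cases x) (simp add: g_def)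
  have finZ: "finite Z"
    by (rule finite_subset[of _ "?P \<times> ?Q"]) (use fin in \<open>auto simp: Z_def\<close>)
  have finW: "finite W" using finZ by (simp add: W_def)
  have "component_value \<phi> n (p \<otimes>\<^bsub>free_sym R B\<^esub> q)
        = (\<Oplus>m\<in>W. (p \<otimes>\<^bsub>free_sym R B\<^esub> q) m \<otimes> ?v m)"
  proof (rule component_value_superset[OF free_sym_mult_closed[OF p q] finW])
    show "{m. (p \<otimes>\<^bsub>free_sym R B\<^esub> q) m \<noteq> \<zero> \<and> size m = n} \<subseteq> W"
    proof
      fix m assume m: "m \<in> {m. (p \<otimes>\<^bsub>free_sym R B\<^esub> q) m \<noteq> \<zero> \<and> size m = n}"
      then obtain k l where "p k \<noteq> \<zero>" "q l \<noteq> \<zero>" "m = k + l"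
        using free_sym_mult_support[OF p q] by blast
      with m have "(k, l) \<in> Z" "m = (\<lambda>(k, l). k + l) (k, l)" by (auto simp: Z_def)
      then show "m \<in> W" unfolding W_def by blast
    qed
  qed (auto simp: W_def Z_def)
  also have "\<dots> = (\<Oplus>m\<in>W. \<Oplus>k\<in>{k. k \<subseteq># m}. g (k, m - k))"
  proof (rule finsum_cong')
    fix m assume "m \<in> W"
    have "(p \<otimes>\<^bsub>free_sym R B\<^esub> q) m \<otimes> ?v m = (\<Oplus>k\<in>{k. k \<subseteq># m}. (p k \<otimes> q (m - k)) \<otimes> ?v m)"
      unfolding free_sym_simps by (rule finsum_ldistr) (auto simp: finite_submultisets)
    also have "\<dots> = (\<Oplus>k\<in>{k. k \<subseteq># m}. g (k, m - k))"
    proof (rule finsum_cong')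
      fix k assume "k \<in> {k. k \<subseteq># m}"
      then have "?v m = ?v k \<otimes> ?v (m - k)"
        using monomial_value_plus[of k "m - k"] by simp
      then show "(p k \<otimes> q (m - k)) \<otimes> ?v m = g (k, m - k)" by (simp add: g_def)
    qed (auto simp: g_closed)
    finally show "(p \<otimes>\<^bsub>free_sym R B\<^esub> q) m \<otimes> ?v m = (\<Oplus>k\<in>{k. k \<subseteq># m}. g (k, m - k))" .
  qed (auto intro!: finsum_closed simp: g_closed)
  also have "\<dots> = (\<Oplus>x\<in>Sigma W (\<lambda>m. {k. k \<subseteq># m}). (\<lambda>(m, k). g (k, m - k)) x)"
    using finsum_Sigma[OF finW, of "\<lambda>m. {k. k \<subseteq># m}" "\<lambda>(m, k). g (k, m - k)"]
    by (simp add: finite_submultisets g_closed)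
  also have "\<dots> = (\<Oplus>x\<in>Sigma W (\<lambda>m. {k. k \<subseteq># m}). g ((\<lambda>(m, k). (k, m - k)) x))"
    by (rule finsum_cong') (auto simp: g_closed)
  also have "\<dots> = (\<Oplus>x\<in>(\<lambda>(m, k). (k, m - k)) ` Sigma W (\<lambda>m. {k. k \<subseteq># m}). g x)"
  proof (rule finsum_reindex[symmetric])
    show "inj_on (\<lambda>(m, k). (k, m - k)) (Sigma W (\<lambda>m. {k. k \<subseteq># m}))"
      by (rule inj_on_inverseI[where g = "\<lambda>(k, l). (k + l, k)"]) auto
  qed (auto simp: g_closed)
  also have "\<dots> = (\<Oplus>x\<in>Z. g x)"
  proof (rule add.finprod_mono_neutral_cong_right)
    show "Z \<subseteq> (\<lambda>(m, k). (k, m - k)) ` Sigma W (\<lambda>m. {k. k \<subseteq># m})"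
    proof
      fix x assume "x \<in> Z"
      obtain k l where x: "x = (k, l)" by fastforce
      have "k + l \<in> W" using \<open>x \<in> Z\<close> unfolding W_def x by force
      then have "(k + l, k) \<in> Sigma W (\<lambda>m. {k. k \<subseteq># m})" by simp
      moreover have "x = (\<lambda>(m, k). (k, m - k)) (k + l, k)" by (simp add: x)
      ultimately show "x \<in> (\<lambda>(m, k). (k, m - k)) ` Sigma W (\<lambda>m. {k. k \<subseteq># m})" by blast
    qed
    show "finite ((\<lambda>(m, k). (k, m - k)) ` Sigma W (\<lambda>m. {k. k \<subseteq># m}))"
      using finW finite_submultisets by blast
    fix x assume x: "x \<in> (\<lambda>(m, k). (k, m - k)) ` Sigma W (\<lambda>m. {k. k \<subseteq># m}) - Z"
    then obtain m k where mk: "x = (k, m - k)" "m \<in> W" "k \<subseteq># m" by auto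
    then have "size k + size (m - k) = n"
      by (auto simp: W_def Z_def size_Diff_submset size_mset_mono)
    with x mk have "p k = \<zero> \<or> q (m - k) = \<zero>" by (auto simp: Z_def)
    then show "g x = \<zero>\<^bsub>R\<^esub>" by (auto simp: g_def mk)
  qed (auto simp: g_closed)
  finally have left: "component_value \<phi> n (p \<otimes>\<^bsub>free_sym R B\<^esub> q) = (\<Oplus>x\<in>Z. g x)" .
  let ?D = "\<lambda>i. {k. p k \<noteq> \<zero> \<and> size k = i} \<times> {l. q l \<noteq> \<zero> \<and> size l = n - i}"
  have finD: "finite {k. p k \<noteq> \<zero> \<and> size k = i}" "finite {l. q l \<noteq> \<zero> \<and> size l = i}" for i
    using fin by (auto intro: finite_subset[rotated])
  have "component_value \<phi> i p \<otimes> component_value \<phi> (n - i) q = (\<Oplus>x\<in>?D i. g x)" for i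
  proof -
    have "component_value \<phi> i p \<otimes> component_value \<phi> (n - i) q
      = (\<Oplus>k\<in>{k. p k \<noteq> \<zero> \<and> size k = i}. p k \<otimes> ?v k \<otimes> component_value \<phi> (n - i) q)"
      unfolding component_value_def[of _ i]
      by (rule finsum_ldistr) (use finD component_value_closed[OF q] in auto)
    also have "\<dots> = (\<Oplus>k\<in>{k. p k \<noteq> \<zero> \<and> size k = i}. \<Oplus>l\<in>{l. q l \<noteq> \<zero> \<and> size l = n - i}. g (k, l))"
    proof (rule finsum_cong')
      fix k
      have "p k \<otimes> ?v k \<otimes> component_value \<phi> (n - i) q
        = (\<Oplus>l\<in>{l. q l \<noteq> \<zero> \<and> size l = n - i}. p k \<otimes> ?v k \<otimes> (q l \<otimes> ?v l))"
        unfolding component_value_def by (rule finsum_rdistr) (use finD in auto)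
      also have "\<dots> = (\<Oplus>l\<in>{l. q l \<noteq> \<zero> \<and> size l = n - i}. g (k, l))"
        by (rule finsum_cong') (auto simp: g_def m_ac)
      finally show "p k \<otimes> ?v k \<otimes> component_value \<phi> (n - i) q
        = (\<Oplus>l\<in>{l. q l \<noteq> \<zero> \<and> size l = n - i}. g (k, l))" .
    qed (auto intro!: finsum_closed simp: g_closed)
    also have "\<dots> = (\<Oplus>x\<in>?D i. g x)"
      by (rule finsum_Sigma) (use finD g_closed in auto)
    finally show ?thesis .
  qed
  then have "(\<Oplus>i\<in>{..n}. component_value \<phi> i p \<otimes> component_value \<phi> (n - i) q)
      = (\<Oplus>i\<in>{..n}. \<Oplus>x\<in>?D i. g x)"
    by simp
  also have "\<dots> = (\<Oplus>x\<in>(\<Union>i\<in>{..n}. ?D i). g x)"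
    by (rule add.finprod_UN_disjoint[symmetric])
       (use finD g_closed in \<open>auto simp: pairwise_def disjnt_def\<close>)
  also have "(\<Union>i\<in>{..n}. ?D i) = Z"
    by (auto simp: Z_def)
  finally show ?thesis using left by simp
qed

lemma component_value_const:
  "n > 0 \<Longrightarrow> component_value \<phi> n (indexed_const r) = \<zero>"
  unfolding component_value_def indexed_const_def by (intro add.finprod_one_eqI) auto

lemma component_value_one:
  "component_value \<phi> n \<one>\<^bsub>free_sym R B\<^esub> = (if n = 0 then \<one> else \<zero>)"
proof -
  have "component_value \<phi> n \<one>\<^bsub>free_sym R B\<^esub>
    = (\<Oplus>m\<in>(if n = 0 then {{#}} else {}). \<one>\<^bsub>free_sym R B\<^esub> m \<otimes> monomial_value \<phi> m)"
    by (rule component_value_superset[OF free_sym_one_closed])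
       (auto simp: free_sym_simps split: if_splits)
  then show ?thesis by (auto simp: free_sym_simps monomial_value_empty)
qed

lemma component_value_linear_form:
  assumes f: "f \<in> carrier (free_module R B)"
  shows "component_value \<phi> n (linear_form R f)
         = (if n = 1 then \<Oplus>b\<in>{b. f b \<noteq> \<zero>}. f b \<otimes> \<phi> b else \<zero>)"
proof -
  have fc: "f b \<in> carrier R" for b using f by (simp add: free_module_def)
  have supp: "{m. linear_form R f m \<noteq> \<zero> \<and> size m = n}
      = (if n = 1 then (\<lambda>b. {#b#}) ` {b. f b \<noteq> \<zero>} else {})"
    using linear_form_support[of f] by (auto simp: linear_form_def)
  show ?thesis
  proof (cases "n = 1")
    case True
    have "component_value \<phi> n (linear_form R f)
      = (\<Oplus>m\<in>(\<lambda>b. {#b#}) ` {b. f b \<noteq> \<zero>}. linear_form R f m \<otimes> monomial_value \<phi> m)"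
      unfolding component_value_def supp using True by simp
    also have "\<dots> = (\<Oplus>b\<in>{b. f b \<noteq> \<zero>}. linear_form R f {#b#} \<otimes> monomial_value \<phi> {#b#})"
      by (rule finsum_reindex) (auto simp: fc linear_form_single inj_on_def)
    finally show ?thesis using True by (simp add: linear_form_single monomial_value_single)
  next
    case False
    then show ?thesis by (simp add: component_value_def supp)
  qed
qed

lemma component_value_linear_form_pow:
  assumes f: "f \<in> carrier (free_module R B)"
  shows "component_value \<phi> n (linear_form R f [^]\<^bsub>free_sym R B\<^esub> i)
         = (if n = i then component_value \<phi> 1 (linear_form R f) [^] i else \<zero>)"
proof (induction i arbitrary: n)
  case 0
  then show ?case by (simp add: component_value_one)
next
  case (Suc i)
  let ?u = "component_value \<phi> 1 (linear_form R f)"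
  have u: "?u \<in> carrier R" using component_value_closed linear_form_closed[OF f] by blast
  have lin: "component_value \<phi> j (linear_form R f) = (if j = 1 then ?u else \<zero>)" for j
    using component_value_linear_form[OF f] by simp
  have "component_value \<phi> n (linear_form R f [^]\<^bsub>free_sym R B\<^esub> Suc i)
    = (\<Oplus>j\<in>{..n}. component_value \<phi> j (linear_form R f [^]\<^bsub>free_sym R B\<^esub> i)
                  \<otimes> component_value \<phi> (n - j) (linear_form R f))"
    using component_value_mult[OF free_sym_pow_closed[OF linear_form_closed[OF f]] linear_form_closed[OF f]]
    by simp
  also have "\<dots> = (\<Oplus>j\<in>{..n}. if i = j then (if n = Suc i then ?u [^] Suc i else \<zero>) else \<zero>)"
  proof (rule finsum_cong')
    fix j assume j: "j \<in> {..n}"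
    show "component_value \<phi> j (linear_form R f [^]\<^bsub>free_sym R B\<^esub> i)
        \<otimes> component_value \<phi> (n - j) (linear_form R f)
      = (if i = j then (if n = Suc i then ?u [^] Suc i else \<zero>) else \<zero>)"
      unfolding lin[of "n - j"] using u j by (auto simp: Suc.IH)
  qed (use u in auto)
  also have "\<dots> = (if n = Suc i then ?u [^] Suc i else \<zero>)"
  proof (cases "i \<le> n")
    case True
    then show ?thesis
      using u by (intro add.finprod_singleton) auto
  next
    case False
    then have "(\<Oplus>j\<in>{..n}. if i = j then (if n = Suc i then ?u [^] Suc i else \<zero>) else \<zero>) = \<zero>"
      by (intro add.finprod_one_eqI) auto
    with False show ?thesis by simp
  qed
  finally show ?case .
qed

text \<open>Modulo \<open>P\<close> the substitution sends the generators in \<open>K\<close> to \<open>0\<close>, hence all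
  of \<open>R[K]\<close> to constants.\<close>

lemma component_value_subalgebra:
  assumes P: "ideal P R" and K: "K \<subseteq> carrier (free_module R B)"
    and K_P: "\<And>f. f \<in> K \<Longrightarrow> component_value \<phi> 1 (linear_form R f) \<in> P"
    and p: "p \<in> generated_subalgebra R B K" and n: "n > 0"
  shows "component_value \<phi> n p \<in> P"
  using p n unfolding generated_subalgebra_def
proof (induction arbitrary: n rule: generate_ring.induct)
  interpret P: ideal P R by fact
  case one
  then show ?case by (simp add: component_value_one)
next
  interpret P: ideal P R by fact
  case (incl h)
  then consider r where "h = indexed_const r" | f where "f \<in> K" "h = linear_form R f" by blast
  then show ?case
  proof cases
    case 1
    then show ?thesis using incl by (simp add: component_value_const)
  next
    case 2
    then show ?thesis
      using K_P[of f] K component_value_linear_form[of f B n] by (cases "n = 1") auto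
  qed
next
  interpret P: ideal P R by fact
  case (a_inv h)
  then have "h \<in> carrier (free_sym R B)"
    using generated_subalgebra_closed[OF K] unfolding generated_subalgebra_def by blast
  then show ?case using a_inv by (simp add: component_value_a_inv)
next
  interpret P: ideal P R by fact
  case (eng_add h1 h2)
  then have "h1 \<in> carrier (free_sym R B)" "h2 \<in> carrier (free_sym R B)"
    using generated_subalgebra_closed[OF K] unfolding generated_subalgebra_def by blast+
  then show ?case using eng_add by (simp add: component_value_add)
next
  interpret P: ideal P R by fact
  case (eng_mult h1 h2)
  then have h: "h1 \<in> carrier (free_sym R B)" "h2 \<in> carrier (free_sym R B)"
    using generated_subalgebra_closed[OF K] unfolding generated_subalgebra_def by blast+
  \<comment> \<open>Since \<open>n > 0\<close>, one of the degrees \<open>i\<close> and \<open>n - i\<close> is positive.\<close>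
  have term_in: "component_value \<phi> i h1 \<otimes> component_value \<phi> (n - i) h2 \<in> P" if "i \<le> n" for i
  proof (cases "i = 0")
    case True
    then show ?thesis
      using eng_mult.IH(2)[of n] eng_mult.prems h P.I_l_closed component_value_closed by simp
  next
    case False
    then show ?thesis
      using eng_mult.IH(1)[of i] h P.I_r_closed component_value_closed by simp
  qed
  have "(\<Oplus>i\<in>{..n}. component_value \<phi> i h1 \<otimes> component_value \<phi> (n - i) h2) \<in> P"
    using term_in by (intro P.finsum_mem) simp
  then show ?case using h by (simp add: component_value_mult)
qed

text \<open>Substituting \<open>\<phi> b \<cdot> t\<close> for \<open>b\<close> sends \<open>R[K]\<close> to constants modulo
  \<open>P\<close> and \<open>z\<close> to \<open>u t\<close>. Comparing coefficients of \<open>t ^ n\<close> in an equation of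
  integral dependence of degree \<open>n\<close> leaves \<open>u ^ n \<in> P\<close>. This is the familiar fact that a
  nonzero multiple of \<open>t\<close> is not integral over a domain of constants.\<close>

lemma component_value_integral_in_prime:
  assumes P: "primeideal P R" and K: "K \<subseteq> carrier (free_module R B)"
    and K_P: "\<And>f. f \<in> K \<Longrightarrow> component_value \<phi> 1 (linear_form R f) \<in> P"
    and z: "z \<in> free_integral_closure R B K"
  shows "component_value \<phi> 1 (linear_form R z) \<in> P"
proof -
  interpret P: primeideal P R by fact
  interpret S: abelian_group "free_sym R B" by (rule abelian_group_free_sym)
  let ?S = "free_sym R B" and ?z = "linear_form R z"
  let ?u = "component_value \<phi> 1 ?z"
  have z_in: "z \<in> carrier (free_module R B)" using z by (simp add: free_integral_closure_def)
  note zc = linear_form_closed[OF z_in]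
  have u: "?u \<in> carrier R" using component_value_closed[OF zc] .
  obtain n :: nat and a where "n > 0"
    and a: "\<And>i. i < n \<Longrightarrow> a i \<in> generated_subalgebra R B K"
    and eq: "?z [^]\<^bsub>?S\<^esub> n \<oplus>\<^bsub>?S\<^esub> (\<Oplus>\<^bsub>?S\<^esub>i\<in>{..<n}. a i \<otimes>\<^bsub>?S\<^esub> ?z [^]\<^bsub>?S\<^esub> i) = \<zero>\<^bsub>?S\<^esub>"
    using z unfolding free_integral_closure_def integral_closure_in_def by blast
  have ac: "a i \<in> carrier ?S" if "i < n" for i
    using generated_subalgebra_closed[OF K a[OF that]] .
  have term_closed: "a i \<otimes>\<^bsub>?S\<^esub> ?z [^]\<^bsub>?S\<^esub> i \<in> carrier ?S" if "i < n" for i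
    using free_sym_mult_closed[OF ac[OF that] free_sym_pow_closed[OF zc]] .
  \<comment> \<open>The power \<open>?z ^ i\<close> lives in degree \<open>i\<close> alone, so only the component of
    \<open>a i\<close> in the positive degree \<open>n - i\<close> contributes.\<close>
  have term_in: "component_value \<phi> n (a i \<otimes>\<^bsub>?S\<^esub> ?z [^]\<^bsub>?S\<^esub> i) \<in> P" if i: "i < n" for i
  proof -
    have "component_value \<phi> n (a i \<otimes>\<^bsub>?S\<^esub> ?z [^]\<^bsub>?S\<^esub> i)
      = (\<Oplus>j\<in>{..n}. component_value \<phi> j (a i) \<otimes> component_value \<phi> (n - j) (?z [^]\<^bsub>?S\<^esub> i))"
      by (rule component_value_mult[OF ac[OF i] free_sym_pow_closed[OF zc]])
    also have "\<dots> = (\<Oplus>j\<in>{..n}. if n - i = j then component_value \<phi> j (a i) \<otimes> ?u [^] i else \<zero>)"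
      by (rule finsum_cong')
         (use i u component_value_closed[OF ac[OF i]] in \<open>auto simp: component_value_linear_form_pow[OF z_in]\<close>)
    also have "\<dots> = component_value \<phi> (n - i) (a i) \<otimes> ?u [^] i"
      by (rule add.finprod_singleton) (use u component_value_closed[OF ac[OF i]] in auto)
    also have "\<dots> \<in> P"
      using component_value_subalgebra[OF P.is_ideal K K_P a[OF i], of "n - i"] i u P.I_r_closed by simp
    finally show ?thesis .
  qed
  have sum_in: "(\<Oplus>i\<in>{..<n}. component_value \<phi> n (a i \<otimes>\<^bsub>?S\<^esub> ?z [^]\<^bsub>?S\<^esub> i)) \<in> P"
    using term_in by (intro P.finsum_mem) simp
  have "?u [^] n \<oplus> (\<Oplus>i\<in>{..<n}. component_value \<phi> n (a i \<otimes>\<^bsub>?S\<^esub> ?z [^]\<^bsub>?S\<^esub> i))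
      = component_value \<phi> n (?z [^]\<^bsub>?S\<^esub> n \<oplus>\<^bsub>?S\<^esub> (\<Oplus>\<^bsub>?S\<^esub>i\<in>{..<n}. a i \<otimes>\<^bsub>?S\<^esub> ?z [^]\<^bsub>?S\<^esub> i))"
  proof -
    have "(\<Oplus>\<^bsub>?S\<^esub>i\<in>{..<n}. a i \<otimes>\<^bsub>?S\<^esub> ?z [^]\<^bsub>?S\<^esub> i) \<in> carrier ?S"
      using term_closed by (intro S.finsum_closed) auto
    moreover have "component_value \<phi> n (\<Oplus>\<^bsub>?S\<^esub>i\<in>{..<n}. a i \<otimes>\<^bsub>?S\<^esub> ?z [^]\<^bsub>?S\<^esub> i)
      = (\<Oplus>i\<in>{..<n}. component_value \<phi> n (a i \<otimes>\<^bsub>?S\<^esub> ?z [^]\<^bsub>?S\<^esub> i))"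
      using term_closed by (intro component_value_finsum) auto
    ultimately show ?thesis
      using component_value_add[OF free_sym_pow_closed[OF zc]]
      by (simp add: component_value_linear_form_pow[OF z_in])
  qed
  also have "\<dots> = \<zero>" by (simp only: eq component_value_zero)
  finally have "\<ominus> (\<Oplus>i\<in>{..<n}. component_value \<phi> n (a i \<otimes>\<^bsub>?S\<^esub> ?z [^]\<^bsub>?S\<^esub> i)) = ?u [^] n"
    by (rule minus_equality[OF _ P.Icarr[OF sum_in] nat_pow_closed[OF u]])
  then have "?u [^] n \<in> P" using P.a_inv_closed[OF sum_in] by simp
  then show ?thesis using P.nat_pow_mem_imp_mem u by blast
qed

end
end

section \<open>The liftable integral closure of zero lies under the socle\<close>

context module
begin

lemma submodule_zero_mem: "submodule N R M \<Longrightarrow> \<zero>\<^bsub>M\<^esub> \<in> N"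
  using submodule.axioms(1) subgroup.one_closed by fastforce

lemma submodule_Union_chain:
  assumes "\<N> \<noteq> {}" "\<And>N. N \<in> \<N> \<Longrightarrow> submodule N R M"
    and "\<And>N N'. N \<in> \<N> \<Longrightarrow> N' \<in> \<N> \<Longrightarrow> N \<subseteq> N' \<or> N' \<subseteq> N"
  shows "submodule (\<Union>\<N>) R M"
proof (rule submoduleI)
  show "\<Union>\<N> \<subseteq> carrier M" using assms(2) submoduleE(1) by blast
  show "\<zero>\<^bsub>M\<^esub> \<in> \<Union>\<N>" using assms(1,2) submodule_zero_mem by blast
  show "\<ominus>\<^bsub>M\<^esub> a \<in> \<Union>\<N>" if "a \<in> \<Union>\<N>" for a
    using that assms(2) submoduleE(3) by blast
  show "r \<odot>\<^bsub>M\<^esub> a \<in> \<Union>\<N>" if "r \<in> carrier R" "a \<in> \<Union>\<N>" for r a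
    using that assms(2) submoduleE(4) by blast
  show "a \<oplus>\<^bsub>M\<^esub> b \<in> \<Union>\<N>" if ab: "a \<in> \<Union>\<N>" "b \<in> \<Union>\<N>" for a b
  proof -
    obtain N N' where "N \<in> \<N>" "a \<in> N" "N' \<in> \<N>" "b \<in> N'" using ab by blast
    then obtain L where "L \<in> \<N>" "a \<in> L" "b \<in> L" using assms(3)[of N N'] by blast
    then show ?thesis using assms(2) submoduleE(5) by blast
  qed
qed

lemma ex_maximal_submodule_avoiding:
  assumes "submodule A R M" "y \<notin> A"
  shows "\<exists>N. submodule N R M \<and> A \<subseteq> N \<and> y \<notin> N \<and>
             (\<forall>N'. submodule N' R M \<longrightarrow> N \<subseteq> N' \<longrightarrow> y \<notin> N' \<longrightarrow> N' = N)"
proof -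
  let ?\<A> = "{N. submodule N R M \<and> A \<subseteq> N \<and> y \<notin> N}"
  have "\<exists>N\<in>?\<A>. \<forall>N'\<in>?\<A>. N \<subseteq> N' \<longrightarrow> N' = N"
  proof (rule subset_Zorn_nonempty)
    show "?\<A> \<noteq> {}" using assms by blast
    fix \<N> assume \<N>: "\<N> \<noteq> {}" "subset.chain ?\<A> \<N>"
    then have "submodule (\<Union>\<N>) R M"
      by (intro submodule_Union_chain) (auto simp: subset_chain_def)
    with \<N> show "\<Union>\<N> \<in> ?\<A>" by (auto simp: subset_chain_def)
  qed
  then obtain N where N: "N \<in> ?\<A>" "\<forall>N'\<in>?\<A>. N \<subseteq> N' \<longrightarrow> N' = N" ..
  then have "N' = N" if "submodule N' R M" "N \<subseteq> N'" "y \<notin> N'" for N'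
    using that by blast
  with N show ?thesis by blast
qed

lemma submodule_adjoin:
  assumes N: "submodule N R M" and v: "v \<in> carrier M"
  shows "submodule {w \<oplus>\<^bsub>M\<^esub> r \<odot>\<^bsub>M\<^esub> v |w r. w \<in> N \<and> r \<in> carrier R} R M" (is "submodule ?L R M")
proof (rule submoduleI)
  note [simp] = v
  have Nc: "w \<in> carrier M" if "w \<in> N" for w using submoduleE(1)[OF N] that by blast
  show "?L \<subseteq> carrier M" using Nc by auto
  have "\<zero>\<^bsub>M\<^esub> = \<zero>\<^bsub>M\<^esub> \<oplus>\<^bsub>M\<^esub> \<zero> \<odot>\<^bsub>M\<^esub> v" by simp
  then show "\<zero>\<^bsub>M\<^esub> \<in> ?L" using submodule_zero_mem[OF N] by blast
  show "a \<oplus>\<^bsub>M\<^esub> b \<in> ?L" if "a \<in> ?L" "b \<in> ?L" for a b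
  proof -
    obtain w r w' r' where *: "a = w \<oplus>\<^bsub>M\<^esub> r \<odot>\<^bsub>M\<^esub> v" "b = w' \<oplus>\<^bsub>M\<^esub> r' \<odot>\<^bsub>M\<^esub> v"
      "w \<in> N" "w' \<in> N" "r \<in> carrier R" "r' \<in> carrier R"
      using \<open>a \<in> ?L\<close> \<open>b \<in> ?L\<close> by blast
    then have "a \<oplus>\<^bsub>M\<^esub> b = (w \<oplus>\<^bsub>M\<^esub> w') \<oplus>\<^bsub>M\<^esub> (r \<oplus> r') \<odot>\<^bsub>M\<^esub> v"
      by (simp add: Nc smult_l_distr M.a_ac)
    then show ?thesis using * submoduleE(5)[OF N] by blast
  qed
  show smult: "r \<odot>\<^bsub>M\<^esub> a \<in> ?L" if r: "r \<in> carrier R" and "a \<in> ?L" for r a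
  proof -
    obtain w r' where *: "a = w \<oplus>\<^bsub>M\<^esub> r' \<odot>\<^bsub>M\<^esub> v" "w \<in> N" "r' \<in> carrier R"
      using \<open>a \<in> ?L\<close> by blast
    then have "r \<odot>\<^bsub>M\<^esub> a = r \<odot>\<^bsub>M\<^esub> w \<oplus>\<^bsub>M\<^esub> (r \<otimes> r') \<odot>\<^bsub>M\<^esub> v"
      using r by (simp add: Nc smult_r_distr smult_assoc1)
    then show ?thesis using * r submoduleE(4)[OF N] by blast
  qed
  show "\<ominus>\<^bsub>M\<^esub> a \<in> ?L" if "a \<in> ?L" for a
  proof -
    have "a \<in> carrier M" using that Nc by auto
    then have "\<ominus>\<^bsub>M\<^esub> a = (\<ominus> \<one>) \<odot>\<^bsub>M\<^esub> a" by (simp add: smult_l_minus)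
    then show ?thesis using smult[OF _ that, of "\<ominus> \<one>"] by simp
  qed
qed

lemma submodule_adjoin_superset:
  assumes N: "submodule N R M" and v: "v \<in> carrier M"
  shows "insert v N \<subseteq> {w \<oplus>\<^bsub>M\<^esub> r \<odot>\<^bsub>M\<^esub> v |w r. w \<in> N \<and> r \<in> carrier R}"
proof -
  have "v = \<zero>\<^bsub>M\<^esub> \<oplus>\<^bsub>M\<^esub> \<one> \<odot>\<^bsub>M\<^esub> v" using v by simp
  moreover have "w = w \<oplus>\<^bsub>M\<^esub> \<zero> \<odot>\<^bsub>M\<^esub> v" if "w \<in> N" for w
    using submoduleE(1)[OF N] that v by auto
  ultimately show ?thesis
    using submodule_zero_mem[OF N] R.one_closed R.zero_closed by blast
qed

lemma submodule_annihilated: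
  assumes s: "s \<in> carrier R"
  shows "submodule {v \<in> carrier M. s \<odot>\<^bsub>M\<^esub> v = \<zero>\<^bsub>M\<^esub>} R M"
proof (rule submoduleI)
  fix r v assume r: "r \<in> carrier R" and v: "v \<in> {v \<in> carrier M. s \<odot>\<^bsub>M\<^esub> v = \<zero>\<^bsub>M\<^esub>}"
  have "s \<odot>\<^bsub>M\<^esub> (r \<odot>\<^bsub>M\<^esub> v) = (s \<otimes> r) \<odot>\<^bsub>M\<^esub> v"
    using s r v by (simp add: smult_assoc1)
  also have "\<dots> = (r \<otimes> s) \<odot>\<^bsub>M\<^esub> v" using s r by (simp add: R.m_comm)
  also have "\<dots> = r \<odot>\<^bsub>M\<^esub> (s \<odot>\<^bsub>M\<^esub> v)" using s r v by (simp add: smult_assoc1)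
  finally show "r \<odot>\<^bsub>M\<^esub> v \<in> {v \<in> carrier M. s \<odot>\<^bsub>M\<^esub> v = \<zero>\<^bsub>M\<^esub>}" using r v by simp
qed (use s in \<open>auto simp: smult_r_distr smult_r_minus\<close>)

text \<open>A choice of coordinates \<open>\<phi> v\<close> with \<open>v \<equiv> \<phi> v \<cdot> y\<close> modulo \<open>N\<close>
  need not be linear, but it is compatible with the evaluation of linear combinations.\<close>

lemma linear_combination_mod:
  assumes N: "submodule N R M" and y: "y \<in> carrier M" and \<phi>: "\<And>v. \<phi> v \<in> carrier R"
    and mod: "\<And>v. v \<in> carrier M \<Longrightarrow> \<exists>w\<in>N. v = \<phi> v \<odot>\<^bsub>M\<^esub> y \<oplus>\<^bsub>M\<^esub> w"
    and c: "\<And>v. c v \<in> carrier R" and V: "finite V" "V \<subseteq> carrier M"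
  shows "\<exists>w\<in>N. (\<Oplus>\<^bsub>M\<^esub>v\<in>V. c v \<odot>\<^bsub>M\<^esub> v) = (\<Oplus>v\<in>V. c v \<otimes> \<phi> v) \<odot>\<^bsub>M\<^esub> y \<oplus>\<^bsub>M\<^esub> w"
  using V
proof (induction V)
  case empty
  have "\<zero>\<^bsub>M\<^esub> = \<zero> \<odot>\<^bsub>M\<^esub> y \<oplus>\<^bsub>M\<^esub> \<zero>\<^bsub>M\<^esub>" using y by simp
  then show ?case using submodule_zero_mem[OF N] by auto
next
  case (insert v V)
  have Nc: "w \<in> carrier M" if "w \<in> N" for w using submoduleE(1)[OF N] that by blast
  obtain w where w: "w \<in> N" "(\<Oplus>\<^bsub>M\<^esub>v\<in>V. c v \<odot>\<^bsub>M\<^esub> v) = (\<Oplus>v\<in>V. c v \<otimes> \<phi> v) \<odot>\<^bsub>M\<^esub> y \<oplus>\<^bsub>M\<^esub> w"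
    using insert by auto
  obtain w' where w': "w' \<in> N" "v = \<phi> v \<odot>\<^bsub>M\<^esub> y \<oplus>\<^bsub>M\<^esub> w'" using mod insert.prems by blast
  define S where "S = (\<Oplus>v\<in>V. c v \<otimes> \<phi> v)"
  have S: "S \<in> carrier R" unfolding S_def by (rule R.finsum_closed) (use c \<phi> in auto)
  have sumR: "(\<Oplus>v\<in>insert v V. c v \<otimes> \<phi> v) = c v \<otimes> \<phi> v \<oplus> S"
    unfolding S_def by (rule R.finsum_insert) (use insert c \<phi> in auto)
  have "(\<Oplus>\<^bsub>M\<^esub>v\<in>insert v V. c v \<odot>\<^bsub>M\<^esub> v) = c v \<odot>\<^bsub>M\<^esub> v \<oplus>\<^bsub>M\<^esub> (\<Oplus>\<^bsub>M\<^esub>v\<in>V. c v \<odot>\<^bsub>M\<^esub> v)"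
    by (rule M.finsum_insert) (use insert c in auto)
  also have "c v \<odot>\<^bsub>M\<^esub> v = (c v \<otimes> \<phi> v) \<odot>\<^bsub>M\<^esub> y \<oplus>\<^bsub>M\<^esub> c v \<odot>\<^bsub>M\<^esub> w'"
  proof -
    have "c v \<odot>\<^bsub>M\<^esub> v = c v \<odot>\<^bsub>M\<^esub> (\<phi> v \<odot>\<^bsub>M\<^esub> y \<oplus>\<^bsub>M\<^esub> w')" using w'(2) by simp
    also have "\<dots> = (c v \<otimes> \<phi> v) \<odot>\<^bsub>M\<^esub> y \<oplus>\<^bsub>M\<^esub> c v \<odot>\<^bsub>M\<^esub> w'"
      using c \<phi> y Nc[OF w'(1)] by (simp add: smult_r_distr smult_assoc1)
    finally show ?thesis .
  qed
  also have "\<dots> \<oplus>\<^bsub>M\<^esub> (\<Oplus>\<^bsub>M\<^esub>v\<in>V. c v \<odot>\<^bsub>M\<^esub> v)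
    = (c v \<otimes> \<phi> v \<oplus> S) \<odot>\<^bsub>M\<^esub> y \<oplus>\<^bsub>M\<^esub> (c v \<odot>\<^bsub>M\<^esub> w' \<oplus>\<^bsub>M\<^esub> w)"
    unfolding w(2) S_def[symmetric]
    using c \<phi> y S Nc[OF w(1)] Nc[OF w'(1)] by (simp add: smult_l_distr M.a_ac)
  finally show ?case
    unfolding sumR using w(1) w'(1) c submoduleE(4,5)[OF N] by blast
qed

end

context artinian_local_ring
begin

text \<open>Under these hypotheses \<open>M / N\<close> is a vector space over the residue field in which
  every nonzero subspace contains the class of \<open>y\<close>; it is therefore the line spanned by that
  class.\<close>

lemma ex_coordinate_mod_submodule:
  assumes M: "module R M" and y: "y \<in> carrier M"
    and N: "submodule N R M" "y \<notin> N"
    and N_max: "\<And>N'. submodule N' R M \<Longrightarrow> N \<subseteq> N' \<Longrightarrow> y \<notin> N' \<Longrightarrow> N' = N"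
    and m_N: "\<And>r v. r \<in> \<mm> \<Longrightarrow> v \<in> carrier M \<Longrightarrow> r \<odot>\<^bsub>M\<^esub> v \<in> N"
    and v: "v \<in> carrier M"
  shows "\<exists>r\<in>carrier R. \<exists>w\<in>N. v = r \<odot>\<^bsub>M\<^esub> y \<oplus>\<^bsub>M\<^esub> w"
proof -
  interpret M: module R M by fact
  have Nc: "w \<in> carrier M" if "w \<in> N" for w using M.submoduleE(1)[OF N(1)] that by blast
  let ?L = "{w \<oplus>\<^bsub>M\<^esub> r \<odot>\<^bsub>M\<^esub> v |w r. w \<in> N \<and> r \<in> carrier R}"
  show ?thesis
  proof (cases "v \<in> N")
    case True
    have "v = \<zero> \<odot>\<^bsub>M\<^esub> y \<oplus>\<^bsub>M\<^esub> v" using v y by simp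
    with True show ?thesis by blast
  next
    case False
    then have "?L \<noteq> N" using M.submodule_adjoin_superset[OF N(1) v] by blast
    then have "y \<in> ?L"
      using N_max[OF M.submodule_adjoin[OF N(1) v]] M.submodule_adjoin_superset[OF N(1) v] by blast
    then obtain w r where wr: "w \<in> N" "r \<in> carrier R" "y = w \<oplus>\<^bsub>M\<^esub> r \<odot>\<^bsub>M\<^esub> v" by blast
    have "r \<notin> \<mm>"
    proof
      assume "r \<in> \<mm>"
      then have "y \<in> N" using m_N[OF _ v] wr M.submoduleE(5)[OF N(1)] by blast
      then show False using N(2) by simp
    qed
    then obtain u where u: "u \<in> carrier R" "u \<otimes> r = \<one>"
      using Units_if_not_in_max wr(2) by blast
    have "u \<odot>\<^bsub>M\<^esub> y = u \<odot>\<^bsub>M\<^esub> w \<oplus>\<^bsub>M\<^esub> (u \<otimes> r) \<odot>\<^bsub>M\<^esub> v"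
      unfolding wr(3) using u(1) wr(1,2) v Nc by (simp add: M.smult_r_distr M.smult_assoc1)
    then have *: "u \<odot>\<^bsub>M\<^esub> y = u \<odot>\<^bsub>M\<^esub> w \<oplus>\<^bsub>M\<^esub> v" using u(2) v by simp
    have uw: "u \<odot>\<^bsub>M\<^esub> w \<in> N" using M.submoduleE(4)[OF N(1)] u(1) wr(1) by blast
    have "v = u \<odot>\<^bsub>M\<^esub> y \<oplus>\<^bsub>M\<^esub> \<ominus>\<^bsub>M\<^esub> (u \<odot>\<^bsub>M\<^esub> w)"
      unfolding * using v Nc[OF uw] by (simp add: M.M.a_ac M.M.r_neg2 M.M.r_neg1 M.M.r_neg M.M.l_neg)
    moreover have "\<ominus>\<^bsub>M\<^esub> (u \<odot>\<^bsub>M\<^esub> w) \<in> N" using M.submoduleE(3)[OF N(1)] uw by blast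
    ultimately show ?thesis using u(1) by blast
  qed
qed

text \<open>Suppose \<open>s y \<noteq> 0\<close>. The elements killed by \<open>s\<close> form a submodule that contains
  \<open>\<mm>M\<close> and misses \<open>y\<close>; enlarge it to a maximal submodule \<open>N\<close> missing
  \<open>y\<close>. Then \<open>M / N\<close> is the line spanned by \<open>y\<close>, and the coordinates
  \<open>\<phi>\<close> on it are values for the variables of the symmetric algebra. Relations of
  \<open>M\<close> evaluate into \<open>\<mm>\<close>, so the same holds for every element of the free module
  integral over them; but an element lying over \<open>y\<close> evaluates to \<open>1\<close> modulo
  \<open>\<mm>\<close>.\<close>

lemma socle_annihilates_li_closure:
  assumes M: "module R M" and s: "s \<in> colon R {\<zero>} \<mm>"
    and y_li: "y \<in> li_closure R M {\<zero>\<^bsub>M\<^esub>}"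
  shows "s \<odot>\<^bsub>M\<^esub> y = \<zero>\<^bsub>M\<^esub>"
proof (rule ccontr)
  interpret M: module R M by fact
  assume sy: "s \<odot>\<^bsub>M\<^esub> y \<noteq> \<zero>\<^bsub>M\<^esub>"
  have sc: "s \<in> carrier R" and s_m: "\<And>r. r \<in> \<mm> \<Longrightarrow> s \<otimes> r = \<zero>"
    using s by (auto simp: colon_def)
  let ?F = "free_module R (carrier M)"
  let ?K = "{f \<in> carrier ?F. canonical_surj R M f \<in> {\<zero>\<^bsub>M\<^esub>}}"
  obtain z where z: "z \<in> free_integral_closure R (carrier M) ?K" and y_z: "y = canonical_surj R M z"
    using y_li unfolding li_closure_def li_closure_wrt_def by blast
  have zF: "z \<in> carrier ?F" using z by (simp add: free_integral_closure_def)
  have y: "y \<in> carrier M"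
    unfolding y_z canonical_surj_def
    by (rule M.M.finsum_closed) (use zF in \<open>auto simp: free_module_def\<close>)
  let ?A = "{v \<in> carrier M. s \<odot>\<^bsub>M\<^esub> v = \<zero>\<^bsub>M\<^esub>}"
  obtain N where N: "submodule N R M" "?A \<subseteq> N" "y \<notin> N"
    and N_max: "\<And>N'. submodule N' R M \<Longrightarrow> N \<subseteq> N' \<Longrightarrow> y \<notin> N' \<Longrightarrow> N' = N"
    using M.ex_maximal_submodule_avoiding[OF M.submodule_annihilated[OF sc], of y] sy by auto
  have m_N: "r \<odot>\<^bsub>M\<^esub> v \<in> N" if r: "r \<in> \<mm>" and v: "v \<in> carrier M" for r v
  proof -
    have "s \<odot>\<^bsub>M\<^esub> (r \<odot>\<^bsub>M\<^esub> v) = (s \<otimes> r) \<odot>\<^bsub>M\<^esub> v"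
      using sc v max.Icarr[OF r] by (simp add: M.smult_assoc1)
    then show ?thesis using N(2) s_m[OF r] v max.Icarr[OF r] by auto
  qed
  \<comment> \<open>The value \<open>0\<close> outside \<open>carrier M\<close> only makes \<open>\<phi>\<close> total.\<close>
  define \<phi> where "\<phi> v = (if v \<in> carrier M
      then SOME r. r \<in> carrier R \<and> (\<exists>w\<in>N. v = r \<odot>\<^bsub>M\<^esub> y \<oplus>\<^bsub>M\<^esub> w) else \<zero>)" for v
  have \<phi>_spec: "\<phi> v \<in> carrier R \<and> (\<exists>w\<in>N. v = \<phi> v \<odot>\<^bsub>M\<^esub> y \<oplus>\<^bsub>M\<^esub> w)" if "v \<in> carrier M" for v
  proof -
    have "\<exists>r. r \<in> carrier R \<and> (\<exists>w\<in>N. v = r \<odot>\<^bsub>M\<^esub> y \<oplus>\<^bsub>M\<^esub> w)"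
      using ex_coordinate_mod_submodule[OF M y N(1,3) N_max m_N that] by blast
    from someI_ex[OF this] show ?thesis using that by (simp add: \<phi>_def)
  qed
  have \<phi>: "\<phi> v \<in> carrier R" for v
    using \<phi>_spec[of v] by (cases "v \<in> carrier M") (auto simp: \<phi>_def)
  have surj_mod: "\<exists>w\<in>N. canonical_surj R M f
      = component_value \<phi> 1 (linear_form R f) \<odot>\<^bsub>M\<^esub> y \<oplus>\<^bsub>M\<^esub> w" if f: "f \<in> carrier ?F" for f
  proof -
    have "finite {v. f v \<noteq> \<zero>}" "{v. f v \<noteq> \<zero>} \<subseteq> carrier M" "\<And>v. f v \<in> carrier R"
      using f by (auto simp: free_module_def)
    then show ?thesis
      using M.linear_combination_mod[OF N(1) y \<phi>, where c = f and V = "{v. f v \<noteq> \<zero>}"] \<phi>_spec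
      unfolding canonical_surj_def component_value_linear_form[OF \<phi> f] by simp
  qed
  have value_closed: "component_value \<phi> 1 (linear_form R f) \<in> carrier R" if "f \<in> carrier ?F" for f
    using component_value_closed[OF \<phi> linear_form_closed[OF that]] .
  have K_m: "component_value \<phi> 1 (linear_form R f) \<in> \<mm>" if f: "f \<in> ?K" for f
  proof (rule ccontr)
    let ?r = "component_value \<phi> 1 (linear_form R f)"
    assume "?r \<notin> \<mm>"
    then obtain u where u: "u \<in> carrier R" "u \<otimes> ?r = \<one>"
      using Units_if_not_in_max value_closed f by blast
    have r: "?r \<in> carrier R" using value_closed f by blast
    obtain w where w: "w \<in> N" "\<zero>\<^bsub>M\<^esub> = ?r \<odot>\<^bsub>M\<^esub> y \<oplus>\<^bsub>M\<^esub> w"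
      using surj_mod[of f] f by auto
    have wc: "w \<in> carrier M" using w(1) M.submoduleE(1)[OF N(1)] by blast
    have "?r \<odot>\<^bsub>M\<^esub> y = \<ominus>\<^bsub>M\<^esub> w"
      using w(2) wc r y by (metis M.M.minus_equality M.smult_closed)
    then have "?r \<odot>\<^bsub>M\<^esub> y \<in> N" using M.submoduleE(3)[OF N(1) w(1)] by simp
    then have "u \<odot>\<^bsub>M\<^esub> (?r \<odot>\<^bsub>M\<^esub> y) \<in> N" using M.submoduleE(4)[OF N(1) u(1)] by blast
    moreover have "u \<odot>\<^bsub>M\<^esub> (?r \<odot>\<^bsub>M\<^esub> y) = y"
      using u r y by (simp flip: M.smult_assoc1)
    ultimately show False using N(3) by simp
  qed
  have "component_value \<phi> 1 (linear_form R z) \<in> \<mm>"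
    by (rule component_value_integral_in_prime[OF \<phi> max.primeideal_axioms _ K_m z]) auto
  then have "component_value \<phi> 1 (linear_form R z) \<odot>\<^bsub>M\<^esub> y \<in> N" using m_N y by blast
  moreover obtain w where "w \<in> N"
    "y = component_value \<phi> 1 (linear_form R z) \<odot>\<^bsub>M\<^esub> y \<oplus>\<^bsub>M\<^esub> w"
    using surj_mod[OF zF] y_z by blast
  ultimately have "y \<in> N" using M.submoduleE(5)[OF N(1)] by metis
  then show False using N(3) by simp
qed

end

section \<open>The regular module and the test ideal of modules\<close>

text \<open>The regular module of \<open>R\<close>, transported along an injection into a type that
  accommodates the modules under consideration.\<close>

definition regular_module_copy :: "('a, 'c) ring_scheme \<Rightarrow> ('a \<Rightarrow> 'u) \<Rightarrow> ('a, 'u) module" where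
  "regular_module_copy R j = \<lparr>
     carrier = j ` carrier R, monoid.mult = undefined, one = undefined,
     ring.zero = j \<zero>\<^bsub>R\<^esub>,
     add = (\<lambda>x y. j (inv_into UNIV j x \<oplus>\<^bsub>R\<^esub> inv_into UNIV j y)),
     smult = (\<lambda>r x. j (r \<otimes>\<^bsub>R\<^esub> inv_into UNIV j x))\<rparr>"

lemma regular_module_copy_simps:
  assumes "inj j"
  shows "carrier (regular_module_copy R j) = j ` carrier R"
    and "\<zero>\<^bsub>regular_module_copy R j\<^esub> = j \<zero>\<^bsub>R\<^esub>"
    and "j r \<oplus>\<^bsub>regular_module_copy R j\<^esub> j s = j (r \<oplus>\<^bsub>R\<^esub> s)"
    and "r \<odot>\<^bsub>regular_module_copy R j\<^esub> j s = j (r \<otimes>\<^bsub>R\<^esub> s)"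
  using assms by (simp_all add: regular_module_copy_def)

lemma (in cring) module_regular_module_copy:
  assumes j: "inj j"
  shows "module R (regular_module_copy R j)"
proof (rule moduleI[OF is_cring])
  note simps = regular_module_copy_simps[OF j]
  show "abelian_group (regular_module_copy R j)"
  proof (rule abelian_groupI)
    fix x assume "x \<in> carrier (regular_module_copy R j)"
    then obtain r where r: "r \<in> carrier R" "x = j r" by (auto simp: simps)
    then have "j (\<ominus> r) \<in> carrier (regular_module_copy R j)" by (simp add: simps)
    moreover have "j (\<ominus> r) \<oplus>\<^bsub>regular_module_copy R j\<^esub> x = \<zero>\<^bsub>regular_module_copy R j\<^esub>"
      using r by (simp add: simps l_neg)
    ultimately show "\<exists>y\<in>carrier (regular_module_copy R j).
        y \<oplus>\<^bsub>regular_module_copy R j\<^esub> x = \<zero>\<^bsub>regular_module_copy R j\<^esub>" by blast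
  qed (auto simp: simps a_assoc intro: arg_cong[OF a_comm])
qed (auto simp: regular_module_copy_simps[OF j] l_distr r_distr m_assoc)

text \<open>Submodules of the regular module are ideals.\<close>

lemma (in artinian_local_ring) artinian_regular_module_copy:
  assumes j: "inj j"
  shows "artinian_module R (regular_module_copy R j)"
  unfolding artinian_module_def
proof (intro conjI allI impI)
  let ?M = "regular_module_copy R j"
  note simps = regular_module_copy_simps[OF j]
  show "module R ?M" by (rule module_regular_module_copy[OF j])
  interpret M: module R ?M by fact
  fix N assume N: "\<forall>i::nat. submodule (N i) R ?M \<and> N (Suc i) \<subseteq> N i"
  define I where "I i = {r \<in> carrier R. j r \<in> N i}" for i
  have "ideal (I i) R" for i
  proof (rule idealI[OF ring_axioms])
    have Ni: "submodule (N i) R ?M" using N by blast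
    have mult: "x \<otimes> a \<in> I i" if "a \<in> I i" "x \<in> carrier R" for a x
      using M.submoduleE(4)[OF Ni that(2), of "j a"] that by (simp add: I_def simps)
    then show "x \<otimes> a \<in> I i" "a \<otimes> x \<in> I i" if "a \<in> I i" "x \<in> carrier R" for a x
      using that m_comm[of a x] by (auto simp: I_def)
    show "subgroup (I i) (add_monoid R)"
    proof (rule add.subgroupI)
      show "I i \<subseteq> carrier R" by (auto simp: I_def)
      have "\<zero> \<in> I i" using M.submodule_zero_mem[OF Ni] by (simp add: I_def simps)
      then show "I i \<noteq> {}" by blast
      fix a assume a: "a \<in> I i"
      then have "(\<ominus> \<one>) \<otimes> a \<in> I i" by (rule mult) simp
      moreover have "a \<in> carrier R" using a by (simp add: I_def)
      ultimately show "\<ominus> a \<in> I i" by (simp add: l_minus)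
      fix b assume b: "b \<in> I i"
      then show "a \<oplus> b \<in> I i"
        using a M.submoduleE(5)[OF Ni, of "j a" "j b"] by (simp add: I_def simps)
    qed
  qed
  moreover have "I (Suc i) \<subseteq> I i" for i using N by (auto simp: I_def)
  ultimately obtain n where n: "\<forall>k\<ge>n. I k = I n"
    using ideal_chain_stabilises by blast
  have "N i = j ` I i" for i
    using N M.submoduleE(1)[of "N i"] by (auto simp: I_def simps)
  with n show "\<exists>n. \<forall>k\<ge>n. N k = N n" by metis
qed

context artinian_local_ring
begin

text \<open>For nilpotent \<open>x\<close> the linear form \<open>x \<cdot> X\<close>, where \<open>X\<close> is the variable
  belonging to the element \<open>1\<close>, is nilpotent and hence integral over every subalgebra. It lies
  over \<open>x \<cdot> 1 = x\<close>.\<close>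

lemma max_subset_li_closure_regular:
  assumes j: "inj j" and x: "x \<in> \<mm>"
  shows "j x \<in> li_closure R (regular_module_copy R j) {\<zero>\<^bsub>regular_module_copy R j\<^esub>}"
proof -
  let ?M = "regular_module_copy R j"
  note simps = regular_module_copy_simps[OF j]
  interpret M: module R ?M by (rule module_regular_module_copy[OF j])
  have xc: "x \<in> carrier R" using x by (rule max.Icarr)
  define f where "f = (\<lambda>v. if v = j \<one> then x else \<zero>)"
  have supp: "{v. f v \<noteq> \<zero>} = (if x = \<zero> then {} else {j \<one>})" by (auto simp: f_def)
  have f: "f \<in> carrier (free_module R (carrier ?M))"
    unfolding free_module_def using supp xc by (auto simp: f_def simps)
  have surj: "canonical_surj R ?M f = j x"
  proof (cases "x = \<zero>")
    case True
    then show ?thesis by (simp add: canonical_surj_def supp simps)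
  next
    case False
    have "(\<Oplus>\<^bsub>?M\<^esub>v\<in>{j \<one>}. f v \<odot>\<^bsub>?M\<^esub> v) = f (j \<one>) \<odot>\<^bsub>?M\<^esub> j \<one>"
      using xc by (subst M.M.finsum_insert) (auto simp: f_def simps)
    with False show ?thesis using xc by (simp add: canonical_surj_def supp f_def simps)
  qed
  obtain n :: nat where n: "n > 0" "x [^] n = \<zero>" using max_nilpotent[OF x] by blast
  interpret P: ideal "PIdl x" R by (rule cgenideal_ideal[OF xc])
  have "linear_form R f m \<in> PIdl x" for m
    using cgenideal_self[OF xc] by (simp add: linear_form_def f_def)
  then have "(linear_form R f [^]\<^bsub>free_sym R (carrier ?M)\<^esub> n) m \<in> PIdl (x [^] n)" for m
    by (rule free_sym_pow_coeff[OF xc])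
  moreover have "PIdl \<zero> = {\<zero>}"
    using cgenideal_eq_genideal[OF zero_closed] genideal_zero by simp
  ultimately have "linear_form R f [^]\<^bsub>free_sym R (carrier ?M)\<^esub> n = \<zero>\<^bsub>free_sym R (carrier ?M)\<^esub>"
    unfolding free_sym_simps by (intro ext) (simp add: n(2))
  then have "f \<in> free_integral_closure R (carrier ?M)
      {f \<in> carrier (free_module R (carrier ?M)). canonical_surj R ?M f \<in> {\<zero>\<^bsub>?M\<^esub>}}"
    using f n(1) by (intro nilpotent_in_integral_closure[of f _ n]) auto
  then have "canonical_surj R ?M f \<in> li_closure R ?M {\<zero>\<^bsub>?M\<^esub>}"
    unfolding li_closure_def li_closure_wrt_def by (rule imageI)
  then show ?thesis by (simp add: surj)
qed

text \<open>The injection provides the one artinian module, \<open>R\<close> itself, that cuts the intersection down to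
  the socle.\<close>

lemma tau_modules_eq_socle:
  assumes "inj (j :: 'a \<Rightarrow> 'u)"
  shows "tau_modules TYPE('u) R = colon R {\<zero>} \<mm>"
proof
  show "colon R {\<zero>} \<mm> \<subseteq> tau_modules TYPE('u) R"
  proof
    fix s assume s: "s \<in> colon R {\<zero>} \<mm>"
    then have sc: "s \<in> carrier R" by (simp add: colon_def)
    show "s \<in> tau_modules TYPE('u) R"
      unfolding tau_modules_def
    proof (rule INT_I)
      fix M :: "('a, 'u) module" assume "M \<in> {M. artinian_module R M}"
      then have "module R M" by (simp add: artinian_module_def)
      from socle_annihilates_li_closure[OF this s]
      have "s \<odot>\<^bsub>M\<^esub> x = \<zero>\<^bsub>M\<^esub>" if "x \<in> li_closure R M {\<zero>\<^bsub>M\<^esub>}" for x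
        using that .
      then show "s \<in> annihilator R M (li_closure R M {\<zero>\<^bsub>M\<^esub>})"
        unfolding annihilator_def using sc by simp
    qed
  qed
  show "tau_modules TYPE('u) R \<subseteq> colon R {\<zero>} \<mm>"
  proof
    let ?M = "regular_module_copy R j"
    fix s assume "s \<in> tau_modules TYPE('u) R"
    then have ann: "s \<in> annihilator R ?M (li_closure R ?M {\<zero>\<^bsub>?M\<^esub>})"
      unfolding tau_modules_def by (rule INT_D) (simp add: artinian_regular_module_copy[OF assms])
    have "s \<otimes> x = \<zero>" if x: "x \<in> \<mm>" for x
    proof -
      have "s \<odot>\<^bsub>?M\<^esub> j x = \<zero>\<^bsub>?M\<^esub>"
        using ann max_subset_li_closure_regular[OF assms x] by (simp add: annihilator_def)
      then have "j (s \<otimes> x) = j \<zero>" by (simp add: regular_module_copy_simps[OF assms])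
      then show ?thesis by (rule injD[OF assms])
    qed
    then show "s \<in> colon R {\<zero>} \<mm>"
      using ann by (simp add: colon_def annihilator_def)
  qed
qed

end

text \<open>Constant functions and singletons embed \<open>R\<close> into the type of the modules' elements.\<close>

theorem proposition4p2:
  fixes R :: "('a, 'c) ring_scheme" (structure) and \<mm> :: "'a set"
  assumes "local_ring R \<mm>"
    and "noetherian_ring R"
    and "krull_dim R = 0"
  shows "tau_ideals R = tau_modules TYPE('m + (nat \<Rightarrow> 'a) set) R \<and>
         tau_modules TYPE('m + (nat \<Rightarrow> 'a) set) R = colon R {\<zero>} \<mm>"
proof -
  interpret artinian_local_ring R \<mm>
    by (intro artinian_local_ring.intro artinian_local_ring_axioms.intro assms)
  have "inj (\<lambda>r :: 'a. Inr {\<lambda>_. r} :: 'm + (nat \<Rightarrow> 'a) set)"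
    by (auto simp: inj_def fun_eq_iff)
  then show ?thesis
    using tau_ideals_eq_socle tau_modules_eq_socle by blast
qed

end
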